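(* Let $p=1+4t^2$ be a prime with $t$ an even integer. Let $\omega$ be a primitive element of $\mathbb{F}_p$, $C_0=\langle\omega^4\rangle\le\mathbb{F}_p^*$, $C_2=\omega^2C_0$, let $H$ be the additive group of $\mathbb{F}_p$, $K=\langle\rho\rangle\le\mathrm{Aut}(H)$ with $\rho(x)=\omega^4x$, and $G=H\rtimes K$. Then $W=\{(-1+c,\phi): c\in C_2,\ \phi\in K\}\subseteq G$ is the connection set of a directed strongly regular Cayley graph on $G$; that is, $\mathrm{Cay}(G,W)$ is a directed strongly regular graph, with parameters $$(v,k,\lambda,\mu,\tau)=\left(\frac{(p-1)p}{4},\ \frac{(p-1)^2}{16},\ \frac{(p-1)^2}{64}-\frac{p-1}{16},\ \frac{(p-1)^2}{64},\ \frac{(p-1)^2}{64}\right).$$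
   Context: $G=H\rtimes K$ is the set $H\times K$ with operation $(h,\phi)(h',\phi')=(h+\phi(h'),\phi\phi')$. For a finite group $G$ and $S\subseteq G$, $\mathrm{Cay}(G,S)$ is the digraph with vertex set $G$ and an arc $(x,y)$ whenever $yx^{-1}\in S$. A directed strongly regular graph with parameters $(v,k,\lambda,\mu,\tau)$ is a finite directed graph $(V,E)$ without loops, $|V|=v$, such that: (1) every vertex has exactly $k$ out-neighbours and exactly $k$ in-neighbours; (2) for every vertex $x$ there are exactly $\tau$ vertices $y$ with $(x,y),(y,x)\in E$; (3) for any distinct vertices $x,y$ the number of $z$ with $(x,z),(z,y)\in E$ is $\lambda$ if $(x,y)\in E$, and $\mu$ otherwise. *)

theory Defs
  imports
    "HOL-Number_Theory.Residues"
    "HOL-Algebra.Bij"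
    "HOL-Algebra.Generated_Groups"
    "HOL-Algebra.Multiplicative_Group"
    "Graph_Theory.Pair_Digraph"
begin

text \<open>
  \<open>semidirect_product H K\<close> is meant for a subgroup \<open>K\<close> of \<open>AutoGroup H\<close>, whose elements are
  extensional functions on \<open>carrier H\<close> and whose multiplication is composition.
\<close>

definition semidirect_product ::
    "('a, 'm) monoid_scheme \<Rightarrow> ('a \<Rightarrow> 'a) set \<Rightarrow> ('a \<times> ('a \<Rightarrow> 'a)) monoid" where
  "semidirect_product H K =
     \<lparr>carrier = carrier H \<times> K,
      monoid.mult = (\<lambda>(h, \<phi>) (h', \<phi>'). (h \<otimes>\<^bsub>H\<^esub> \<phi> h', \<phi> \<otimes>\<^bsub>AutoGroup H\<^esub> \<phi>')),
      one = (\<one>\<^bsub>H\<^esub>, \<one>\<^bsub>AutoGroup H\<^esub>)\<rparr>"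

lemma group_semidirect_product:
  assumes "group H" and "subgroup K (AutoGroup H)"
  shows "group (semidirect_product H K)"
proof -
  interpret H: group H by fact
  interpret A: group "AutoGroup H" by (rule H.AutoGroup)
  interpret K: subgroup K "AutoGroup H" by fact
  have K_auto: "\<phi> \<in> hom H H" "\<phi> \<in> Bij (carrier H)" if "\<phi> \<in> K" for \<phi>
    using that K.subset by (auto simp: AutoGroup_def auto_def)
  have app: "(\<phi> \<otimes>\<^bsub>AutoGroup H\<^esub> \<psi>) x = \<phi> (\<psi> x)"
    if "\<phi> \<in> K" "\<psi> \<in> K" "x \<in> carrier H" for \<phi> \<psi> x
    using that K_auto by (simp add: AutoGroup_def BijGroup_def compose_def)
  have one_app: "\<one>\<^bsub>AutoGroup H\<^esub> x = x" if "x \<in> carrier H" for x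
    using that by (simp add: AutoGroup_def BijGroup_def)
  have closed: "\<phi> x \<in> carrier H" if "\<phi> \<in> K" "x \<in> carrier H" for \<phi> x
    using that K_auto by (auto simp: hom_def)
  have hom: "\<phi> (x \<otimes>\<^bsub>H\<^esub> y) = \<phi> x \<otimes>\<^bsub>H\<^esub> \<phi> y"
    if "\<phi> \<in> K" "x \<in> carrier H" "y \<in> carrier H" for \<phi> x y
    using that K_auto by (auto simp: hom_def)
  show ?thesis
  proof (rule groupI)
    fix x assume "x \<in> carrier (semidirect_product H K)"
    then obtain h \<phi> where x: "x = (h, \<phi>)" "h \<in> carrier H" "\<phi> \<in> K"
      by (auto simp: semidirect_product_def)
    let ?\<psi> = "inv\<^bsub>AutoGroup H\<^esub> \<phi>"
    have "?\<psi> \<in> K" "?\<psi> \<otimes>\<^bsub>AutoGroup H\<^esub> \<phi> = \<one>\<^bsub>AutoGroup H\<^esub>"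
      using x K.subset by auto
    then have "(?\<psi> (inv\<^bsub>H\<^esub> h), ?\<psi>) \<otimes>\<^bsub>semidirect_product H K\<^esub> x =
        \<one>\<^bsub>semidirect_product H K\<^esub>"
      using x hom[of ?\<psi> "inv\<^bsub>H\<^esub> h" h]
        hom[of ?\<psi> "\<one>\<^bsub>H\<^esub>" "\<one>\<^bsub>H\<^esub>"] closed[of ?\<psi> "\<one>\<^bsub>H\<^esub>"]
      by (simp add: semidirect_product_def)
    moreover have "(?\<psi> (inv\<^bsub>H\<^esub> h), ?\<psi>) \<in> carrier (semidirect_product H K)"
      using x \<open>?\<psi> \<in> K\<close> closed by (simp add: semidirect_product_def)
    ultimately show "\<exists>y\<in>carrier (semidirect_product H K).
        y \<otimes>\<^bsub>semidirect_product H K\<^esub> x = \<one>\<^bsub>semidirect_product H K\<^esub>" by blast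
  next
    fix x y z
    assume "x \<in> carrier (semidirect_product H K)" "y \<in> carrier (semidirect_product H K)"
      "z \<in> carrier (semidirect_product H K)"
    then show "x \<otimes>\<^bsub>semidirect_product H K\<^esub> y \<otimes>\<^bsub>semidirect_product H K\<^esub> z =
        x \<otimes>\<^bsub>semidirect_product H K\<^esub> (y \<otimes>\<^bsub>semidirect_product H K\<^esub> z)"
      using K.subset
      by (auto simp: semidirect_product_def hom app closed H.m_assoc A.m_assoc subset_iff)
  qed (auto simp: semidirect_product_def one_app closed)
qed

definition cayley_digraph :: "('a, 'm) monoid_scheme \<Rightarrow> 'a set \<Rightarrow> 'a pair_pre_digraph" where
  "cayley_digraph G S =
     \<lparr>pverts = carrier G,
      parcs = {(x, y). x \<in> carrier G \<and> y \<in> carrier G \<and> y \<otimes>\<^bsub>G\<^esub> inv\<^bsub>G\<^esub> x \<in> S}\<rparr>"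

text \<open>
  The arguments follow the traditional order \<open>(v, k, \<lambda>, \<mu>, \<tau>)\<close>. The locale \<open>pair_digraph\<close> requires
  a finite vertex set, arcs between vertices, and no loops.
\<close>

definition directed_srg ::
    "'a pair_pre_digraph \<Rightarrow> nat \<Rightarrow> nat \<Rightarrow> nat \<Rightarrow> nat \<Rightarrow> nat \<Rightarrow> bool" where
  "directed_srg \<Gamma> v k l m \<tau> \<longleftrightarrow>
     pair_digraph \<Gamma> \<and> card (pverts \<Gamma>) = v \<and>
     (\<forall>x\<in>pverts \<Gamma>. card {y. (x, y) \<in> parcs \<Gamma>} = k \<and> card {y. (y, x) \<in> parcs \<Gamma>} = k) \<and>
     (\<forall>x\<in>pverts \<Gamma>. card {y. (x, y) \<in> parcs \<Gamma> \<and> (y, x) \<in> parcs \<Gamma>} = \<tau>) \<and>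
     (\<forall>x\<in>pverts \<Gamma>. \<forall>y\<in>pverts \<Gamma>. x \<noteq> y \<longrightarrow>
        card {z. (x, z) \<in> parcs \<Gamma> \<and> (z, y) \<in> parcs \<Gamma>} = (if (x, y) \<in> parcs \<Gamma> then l else m))"

text \<open>
  For \<open>p = 1 + 4 t\<^sup>2\<close> with \<open>t\<close> even, none of the divisions and subtractions on \<open>nat\<close> in the
  parameters below truncates.
\<close>

lemma parameters_exact:
  fixes p :: nat and t :: int
  assumes "int p = 1 + 4 * t\<^sup>2" and "even t"
  shows "p \<ge> 1" "4 dvd (p - 1) * p" "16 dvd (p - 1)\<^sup>2" "64 dvd (p - 1)\<^sup>2" "16 dvd p - 1"
    and "(p - 1) div 16 \<le> (p - 1)\<^sup>2 div 64"
proof -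
  obtain s where "t = 2 * s" using assms(2) by blast
  then have "int p = 1 + 16 * int ((nat \<bar>s\<bar>)\<^sup>2)" using assms(1) by (simp add: power2_eq_square)
  then have "p = 1 + 16 * (nat \<bar>s\<bar>)\<^sup>2" by linarith
  then obtain n :: nat where n: "p = 1 + 16 * n" by blast
  have sq: "(p - 1)\<^sup>2 = 64 * (4 * n\<^sup>2)" using n by (simp add: power2_eq_square)
  show "p \<ge> 1" "4 dvd (p - 1) * p" "16 dvd p - 1" using n by simp_all
  show "64 dvd (p - 1)\<^sup>2" unfolding sq by simp
  then show "16 dvd (p - 1)\<^sup>2" using dvd_trans[of 16 64 "(p - 1)\<^sup>2"] by simp
  show "(p - 1) div 16 \<le> (p - 1)\<^sup>2 div 64" unfolding sq using n by (simp add: power2_eq_square)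
qed

end

theory Submission
  imports Defs
begin

text \<open>
  Write \<open>A = -1 + C2\<close>, so that \<open>W = A \<times> K\<close>, and note \<open>0 \<notin> A\<close>. A product \<open>(a, \<phi>) (a', \<phi>')\<close> equals
  \<open>(h, \<psi>)\<close> iff \<open>\<phi> a' = h - a\<close> and \<open>\<phi>' = \<phi>\<inverse> \<psi>\<close>. Hence the two-path counts are those of a directed
  strongly regular graph as soon as every nonzero \<open>y\<close> has the same number \<open>m\<close> of representations
  \<open>y = c a'\<close> with \<open>c \<in> C0\<close>, \<open>a' \<in> A\<close>, i.e. as soon as \<open>A\<close> meets each coset of \<open>C0\<close> in \<open>m = (p - 1) / 16\<close>
  points.

  Let \<open>n_i\<close> be the number of \<open>x \<in> C2\<close> with \<open>x - 1\<close> in the \<open>i\<close>-th coset. The map \<open>x \<mapsto> 1 / x\<close> gives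
  \<open>n_0 = n_2\<close> and \<open>n_1 = n_3\<close>. With \<open>\<chi>\<close> the quadratic character, the sum of \<open>\<chi> (x - 1)\<close> over \<open>C2\<close> is
  \<open>2 (n_0 - n_1)\<close>, and it can be expressed by the Jacobsthal sum \<open>J(a) = \<Sum>x. \<chi> x * \<chi> (x\<^sup>2 + a)\<close>, which gives
  \<open>J(-1) = -2 - 8 (n_0 - n_1)\<close>. Jacobsthal's identity \<open>J(-1)\<^sup>2 + J(-\<omega>)\<^sup>2 = 4 p\<close> and the uniqueness of
  \<open>p = 1\<^sup>2 + (2 t)\<^sup>2\<close> as a sum of two squares force \<open>J(-1) = \<plusminus>2\<close>, hence \<open>n_0 = n_1\<close>.
\<close>

section \<open>Sums over periodic and over paired indices\<close>

lemma sum_lessThan_periodic: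
  fixes g :: "nat \<Rightarrow> 'a::comm_semiring_1"
  assumes "\<And>k. g (k + n) = g k"
  shows "(\<Sum>k<m * n. g k) = of_nat m * (\<Sum>k<n. g k)"
proof -
  have shift: "g (k + i * n) = g k" for k i
  proof (induction i)
    case (Suc i)
    then show ?case using assms[of "k + i * n"] by (simp add: algebra_simps)
  qed simp
  show ?thesis
  proof (induction m)
    case (Suc m)
    have "(\<Sum>k<Suc m * n. g k) = (\<Sum>k<m * n. g k) + (\<Sum>k=m * n..<m * n + n. g k)"
      by (simp add: sum.atLeastLessThan_concat add.commute lessThan_atLeast0)
    also have "(\<Sum>k=m * n..<m * n + n. g k) = (\<Sum>k<n. g (k + m * n))"
      using sum.shift_bounds_nat_ivl[of g 0 "m * n" n] by (simp add: lessThan_atLeast0 add.commute)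
    finally show ?case using Suc by (simp add: shift algebra_simps)
  qed simp
qed

lemma sum_lessThan_double:
  fixes g :: "nat \<Rightarrow> 'a::comm_monoid_add"
  shows "(\<Sum>k<2 * n. g k) = (\<Sum>k<n. g (2 * k) + g (2 * k + 1))"
  by (induction n) (auto simp: add_ac)

section \<open>Representation as a sum of two squares\<close>

text \<open>Brahmagupta's identity gives \<open>q^2 = (u + v * T)^2 + (v - u * T)^2\<close>. If
  \<open>q\<close> divides the second base with quotient \<open>e\<close>, then \<open>e = 0\<close>
  forces \<open>v = u * T\<close>, so \<open>q = u^2 * q\<close>. Otherwise
  \<open>e^2 \<ge> 1\<close> leaves no room for the first square, and \<open>u = - v * T\<close>
  would be even.\<close>

lemma two_squares_unique_aux:
  fixes q T u v :: int
  assumes q: "q = 1 + T\<^sup>2" "q = u\<^sup>2 + v\<^sup>2" and "even T" "odd u" and dvd: "q dvd v - u * T"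
  shows "u\<^sup>2 = 1"
proof -
  have "q > 0" using q by (simp add: add_pos_nonneg)
  obtain e where e: "v - u * T = q * e" using dvd by blast
  have "q * q = (1 + T\<^sup>2) * (u\<^sup>2 + v\<^sup>2)" using q by metis
  also have "\<dots> = (u + v * T)\<^sup>2 + (v - u * T)\<^sup>2"
    by (simp add: power2_eq_square algebra_simps)
  finally have sq: "(u + v * T)\<^sup>2 = q\<^sup>2 * (1 - e\<^sup>2)"
    unfolding e by (simp add: power2_eq_square algebra_simps)
  show ?thesis
  proof (cases "e = 0")
    case True
    then have "v = u * T" using e by simp
    then have "q = u\<^sup>2 * q" using q by (simp add: power2_eq_square algebra_simps)
    then show ?thesis using \<open>q > 0\<close> by simp
  next
    case False
    then have "e\<^sup>2 \<ge> 1" by (smt (verit) zero_less_power2)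
    then have "q\<^sup>2 * (1 - e\<^sup>2) \<le> 0" by (simp add: mult_nonneg_nonpos)
    then have "u + v * T = 0" using sq by (metis power2_less_eq_zero_iff)
    then have "even u" using \<open>even T\<close> by (metis add_eq_0_iff even_minus even_mult_iff)
    then show ?thesis using \<open>odd u\<close> by simp
  qed
qed

text \<open>Since \<open>T^2 = q - 1\<close>, the product \<open>(v - u * T) * (v + u * T)\<close>
  equals \<open>q * (1 - u^2)\<close>, so the prime \<open>q\<close> divides one factor. Replacing
  \<open>v\<close> by \<open>- v\<close> exchanges the factors. The parity conditions decide which
  of the two squares is 1.\<close>

lemma two_squares_unique:
  fixes q T u v :: int
  assumes "prime q" and q: "q = 1 + T\<^sup>2" "q = u\<^sup>2 + v\<^sup>2" and "even T" "odd u"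
  shows "u\<^sup>2 = 1"
proof -
  have "(v - u * T) * (v + u * T) = v\<^sup>2 - u\<^sup>2 * T\<^sup>2" by (simp add: power2_eq_square algebra_simps)
  also have "\<dots> = (q - u\<^sup>2) - u\<^sup>2 * (q - 1)" using q by (metis add_diff_cancel_left')
  also have "\<dots> = q * (1 - u\<^sup>2)" by (simp add: algebra_simps)
  finally have "q dvd v - u * T \<or> q dvd v + u * T"
    using \<open>prime q\<close> by (metis dvd_triv_left prime_dvd_mult_iff)
  then show ?thesis
  proof
    assume "q dvd v + u * T"
    then have "q dvd - v - u * T" by (metis dvd_minus_iff minus_add_distrib uminus_add_conv_diff diff_conv_add_uminus)
    then show ?thesis using two_squares_unique_aux[of q T u "- v"] assms by simp
  qed (use two_squares_unique_aux[of q T u v] assms in simp)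
qed

section \<open>The quadratic character and sums over residues\<close>

text \<open>The primitive root is an integer and all statements are congruences, so that parities,
  signs and finite sums can be handled in \<open>int\<close> without passing through the residue
  ring.\<close>

locale primitive_root =
  fixes p :: nat and w :: int
  assumes prime_p: "prime p" and odd_p: "odd p" and w_unit: "\<not> int p dvd w"
    and generates: "\<And>x. \<not> int p dvd x \<Longrightarrow> \<exists>k. [x = w ^ k] (mod int p)"
begin

section \<open>Enumeration of the nonzero residues by powers of the primitive root\<close>

lemma prime_int_p: "prime (int p)"
  using prime_p by simp

lemma p_gt_2: "p > 2"
  using prime_p odd_p prime_ge_2_nat[of p] by (cases "p = 2") auto

lemma pow_unit: "\<not> int p dvd w ^ k"
  using w_unit prime_dvd_power prime_int_p by blast

lemma fermat: "[w ^ (p - 1) = 1] (mod int p)"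
proof -
  interpret residues_prime p "residue_ring (int p)"
    using prime_p by unfold_locales
  have "coprime w (int p)"
    using w_unit prime_int_p by (metis coprime_commute prime_imp_coprime)
  then show ?thesis using euler_theorem prime_totient_eq by simp
qed

lemma pow_cong:
  assumes "[i = j] (mod p - 1)"
  shows "[w ^ i = w ^ j] (mod int p)"
proof -
  have "[w ^ k = w ^ (k mod (p - 1))] (mod int p)" for k
  proof -
    have "w ^ k = (w ^ (p - 1)) ^ (k div (p - 1)) * w ^ (k mod (p - 1))"
      by (metis mult_div_mod_eq power_add power_mult)
    moreover have "[\<dots> = 1 ^ (k div (p - 1)) * w ^ (k mod (p - 1))] (mod int p)"
      by (intro cong_mult cong_pow fermat cong_refl)
    ultimately show ?thesis by simp
  qed
  from this[of i] this[of j] show ?thesis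
    using assms unfolding cong_def by metis
qed

text \<open>By Fermat the exponents can be reduced modulo \<open>p - 1\<close>, so the map is onto.
  Both sets have \<open>p - 1\<close> elements, hence it is injective as well.\<close>

lemma bij_pow: "bij_betw (\<lambda>k. w ^ k mod int p) {..<p - 1} {1..<int p}"
proof -
  let ?e = "\<lambda>k. w ^ k mod int p"
  have "?e k \<in> {1..<int p}" for k
  proof -
    have "?e k \<noteq> 0" using pow_unit[of k] by (simp add: dvd_eq_mod_eq_0)
    moreover have "?e k \<ge> 0" "?e k < int p" using p_gt_2 by simp_all
    ultimately show ?thesis by simp
  qed
  moreover have "x \<in> ?e ` {..<p - 1}" if "x \<in> {1..<int p}" for x
  proof -
    have "\<not> int p dvd x" using that zdvd_imp_le[of "int p" x] by auto
    then obtain k where "[x = w ^ k] (mod int p)" using generates by blast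
    also have "[w ^ k = w ^ (k mod (p - 1))] (mod int p)" by (rule pow_cong) simp
    finally have "x = ?e (k mod (p - 1))" using that by (simp add: cong_def)
    then show ?thesis using p_gt_2 by simp
  qed
  ultimately have img: "?e ` {..<p - 1} = {1..<int p}" by blast
  moreover have "inj_on ?e {..<p - 1}"
    by (rule eq_card_imp_inj_on) (simp_all add: img p_gt_2[THEN order_less_imp_le] del: One_nat_def)
  ultimately show ?thesis by (simp add: bij_betw_def)
qed

lemma pow_cong_iff: "[w ^ i = w ^ j] (mod int p) \<longleftrightarrow> [i = j] (mod p - 1)"
proof
  assume "[w ^ i = w ^ j] (mod int p)"
  moreover have "[w ^ i = w ^ (i mod (p - 1))] (mod int p)" "[w ^ j = w ^ (j mod (p - 1))] (mod int p)"
    by (auto intro: pow_cong)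
  ultimately have "w ^ (i mod (p - 1)) mod int p = w ^ (j mod (p - 1)) mod int p"
    by (simp add: cong_def)
  then show "[i = j] (mod p - 1)"
    using bij_pow p_gt_2 unfolding bij_betw_def cong_def by (auto dest: inj_onD)
qed (rule pow_cong)

section \<open>Discrete logarithm and quadratic character\<close>

lemma even_p_minus_1: "even (p - 1)"
  using odd_p by simp

text \<open>Choosing the least exponent makes the value a function of the residue class of
  \<open>x\<close>. For multiples of \<open>p\<close> no exponent exists and the value is
  unspecified.\<close>

definition dlog :: "int \<Rightarrow> nat" where
  "dlog x = (LEAST k. [x = w ^ k] (mod int p))"

lemma dlog: "\<not> int p dvd x \<Longrightarrow> [x = w ^ dlog x] (mod int p)"
  unfolding dlog_def using generates by (rule LeastI_ex)

lemma dlog_cong: "[x = y] (mod int p) \<Longrightarrow> dlog x = dlog y"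
  unfolding dlog_def cong_def by simp

lemma dlog_pow: "[dlog (w ^ k) = k] (mod p - 1)"
  using dlog[OF pow_unit, of k] by (simp add: pow_cong_iff cong_sym_eq)

lemma dlog_mult:
  assumes "\<not> int p dvd x" "\<not> int p dvd y"
  shows "[dlog (x * y) = dlog x + dlog y] (mod p - 1)"
proof -
  have "[x * y = w ^ (dlog x + dlog y)] (mod int p)"
    using cong_mult[OF dlog dlog, OF assms] by (simp add: power_add)
  then show ?thesis using dlog_cong dlog_pow by metis
qed

text \<open>The Legendre symbol: the squares are the even powers of \<open>w\<close>, and parity of
  exponents is well defined because \<open>p - 1\<close> is even.\<close>

definition chi :: "int \<Rightarrow> int" where
  "chi x = (if int p dvd x then 0 else (- 1) ^ dlog x)"

lemma minus_1_power_cong: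
  assumes "[i = j] (mod p - 1)" shows "(- 1 :: int) ^ i = (- 1) ^ j"
proof -
  have "[i = j] (mod 2)" using cong_dvd_modulus_nat[OF assms] even_p_minus_1 by simp
  then have "even i = even j" by (simp add: cong_def even_iff_mod_2_eq_zero)
  then show ?thesis by (simp add: minus_one_power_iff)
qed

lemma chi_pow [simp]: "chi (w ^ k) = (- 1) ^ k"
  using minus_1_power_cong[OF dlog_pow] by (simp add: chi_def pow_unit)

lemma chi_cong: "[x = y] (mod int p) \<Longrightarrow> chi x = chi y"
  using dlog_cong cong_dvd_iff unfolding chi_def by metis

lemma chi_mult: "chi (x * y) = chi x * chi y"
  using minus_1_power_cong[OF dlog_mult, of x y] prime_int_p
  by (auto simp: chi_def prime_dvd_mult_iff power_add)

lemma chi_zero [simp]: "chi 0 = 0" and chi_one [simp]: "chi 1 = 1" and chi_w [simp]: "chi w = - 1"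
  using chi_pow[of 0] chi_pow[of 1] by (auto simp: chi_def)

lemma chi_square: "chi x * chi x = (if int p dvd x then 0 else 1)"
  by (simp add: chi_def flip: power_mult_distrib)

section \<open>Complete sums modulo \<open>p\<close> and their substitution rules\<close>

abbreviation rsum :: "(int \<Rightarrow> int) \<Rightarrow> int" where
  "rsum f \<equiv> (\<Sum>x\<in>{0..<int p}. f x)"

text \<open>A map that is injective modulo \<open>p\<close> permutes the finitely many residues;
  periodicity of \<open>f\<close> makes the reduction of \<open>g x\<close> harmless.\<close>

lemma rsum_bij:
  assumes f: "\<And>x y. [x = y] (mod int p) \<Longrightarrow> f x = f y"
    and g: "\<And>x y. [g x = g y] (mod int p) \<Longrightarrow> [x = y] (mod int p)"
  shows "rsum (\<lambda>x. f (g x)) = rsum f"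
proof -
  let ?h = "\<lambda>x. g x mod int p"
  have inj: "inj_on ?h {0..<int p}"
  proof (rule inj_onI)
    fix x y assume "x \<in> {0..<int p}" "y \<in> {0..<int p}" "?h x = ?h y"
    then show "x = y" using g[of x y] by (auto simp: cong_def)
  qed
  have "?h ` {0..<int p} \<subseteq> {0..<int p}" using p_gt_2 by auto
  then have "bij_betw ?h {0..<int p} {0..<int p}"
    using inj endo_inj_surj[of "{0..<int p}" ?h] by (simp add: bij_betw_def)
  then have "rsum (\<lambda>x. f (?h x)) = rsum f" by (rule sum.reindex_bij_betw)
  moreover have "f (?h x) = f (g x)" for x by (rule f) (simp add: cong_def)
  ultimately show ?thesis by simp
qed

lemma rsum_shift:
  assumes "\<And>x y. [x = y] (mod int p) \<Longrightarrow> f x = f y"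
  shows "rsum (\<lambda>x. f (x + c)) = rsum f" "rsum (\<lambda>x. f (c + x)) = rsum f"
  by (rule rsum_bij[OF assms]; simp add: cong_add_lcancel cong_add_rcancel)+

lemma rsum_scale:
  assumes "\<And>x y. [x = y] (mod int p) \<Longrightarrow> f x = f y" and "\<not> int p dvd b"
  shows "rsum (\<lambda>x. f (b * x)) = rsum f"
proof (rule rsum_bij[OF assms(1)])
  have "coprime b (int p)"
    using assms(2) prime_int_p by (metis coprime_commute prime_imp_coprime)
  then show "[b * x = b * y] (mod int p) \<Longrightarrow> [x = y] (mod int p)" for x y
    by (simp add: cong_mult_lcancel)
qed

lemma rsum_split: "rsum f = f 0 + (\<Sum>x\<in>{1..<int p}. f x)"
proof -
  have "{0..<int p} = insert 0 {1..<int p}" using p_gt_2 by auto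
  then show ?thesis by simp
qed

lemma rsum_pow:
  assumes "\<And>x y. [x = y] (mod int p) \<Longrightarrow> f x = f y"
  shows "rsum f = f 0 + (\<Sum>k<p - 1. f (w ^ k))"
proof -
  have "(\<Sum>x\<in>{1..<int p}. f x) = (\<Sum>k<p - 1. f (w ^ k mod int p))"
    using sum.reindex_bij_betw[OF bij_pow, of f] by simp
  also have "\<dots> = (\<Sum>k<p - 1. f (w ^ k))"
    by (intro sum.cong assms) (auto simp: cong_def)
  finally show ?thesis by (simp add: rsum_split)
qed

text \<open>The substitution of \<open>w * x\<close> for \<open>x\<close> reverses the sign, as
  \<open>chi w = - 1\<close>.\<close>

lemma rsum_chi: "rsum chi = 0"
proof -
  have "rsum chi = rsum (\<lambda>x. chi (w * x))"
    by (rule rsum_scale[symmetric, OF chi_cong w_unit])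
  also have "\<dots> = - rsum chi" by (simp add: chi_mult sum_negf)
  finally show ?thesis by simp
qed

text \<open>The weight \<open>1 + chi x\<close> is the number of square roots of \<open>x\<close>.
  In terms of exponents, \<open>w ^ (2 * k)\<close> runs twice through the even powers, where the
  weight is 2, and the weight vanishes on odd powers.\<close>

lemma rsum_square:
  assumes f: "\<And>x y. [x = y] (mod int p) \<Longrightarrow> f x = f y"
  shows "rsum (\<lambda>y. f (y\<^sup>2)) = rsum (\<lambda>x. (1 + chi x) * f x)"
proof -
  obtain h where h: "p - 1 = 2 * h" using even_p_minus_1 by blast
  have "rsum (\<lambda>y. f (y\<^sup>2)) = f 0 + (\<Sum>k<p - 1. f ((w ^ k)\<^sup>2))"
    by (subst rsum_pow) (auto intro: f cong_pow)
  also have "(\<Sum>k<p - 1. f ((w ^ k)\<^sup>2)) = (\<Sum>k<2 * h. f (w ^ (2 * k)))"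
    unfolding h by (simp add: mult.commute flip: power_mult)
  also have "\<dots> = 2 * (\<Sum>k<h. f (w ^ (2 * k)))"
    by (subst sum_lessThan_periodic) (auto intro!: f pow_cong simp: h[simplified] cong_def algebra_simps)
  also have "\<dots> = (\<Sum>k<2 * h. (1 + chi (w ^ k)) * f (w ^ k))"
    by (simp add: sum_lessThan_double sum_distrib_left)
  also have "f 0 + \<dots> = rsum (\<lambda>x. (1 + chi x) * f x)"
    unfolding h[symmetric] by (subst rsum_pow) (auto intro!: arg_cong2[where f = "(*)"] f chi_cong)
  finally show ?thesis .
qed

lemma rsum_const_nonzero: "rsum (\<lambda>d. if int p dvd d then a else b) = a + (int p - 1) * b"
proof -
  have "(\<Sum>d\<in>{1..<int p}. if int p dvd d then a else b) = (\<Sum>d\<in>{1..<int p}. b)"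
    by (intro sum.cong) (auto dest: zdvd_imp_le)
  then show ?thesis using p_gt_2 by (simp add: rsum_split)
qed

text \<open>Scaling \<open>a\<close> by a unit \<open>d\<close> shows that the sum is the same for
  all units \<open>d\<close>. Summed over all \<open>d\<close>, including 0, the total is 0 because
  each inner sum of \<open>chi (a + d)\<close> vanishes; the value \<open>p - 1\<close> at 0 then
  determines the common value.\<close>

lemma rsum_chi_mult_shift:
  "rsum (\<lambda>a. chi a * chi (a + d)) = (if int p dvd d then int p - 1 else - 1)"
proof -
  define J where "J d = rsum (\<lambda>a. chi a * chi (a + d))" for d
  have J_cong: "J x = J y" if "[x = y] (mod int p)" for x y
    unfolding J_def using that
    by (intro sum.cong refl arg_cong2[where f = "(*)"] chi_cong cong_add cong_refl)
  have J_zero: "J d = int p - 1" if "int p dvd d" for d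
  proof -
    have "J d = J 0" using that by (intro J_cong) (simp add: cong_0_iff)
    then show ?thesis by (simp add: J_def chi_square rsum_const_nonzero)
  qed
  have J_one: "J d = J 1" if "\<not> int p dvd d" for d
  proof -
    have "J d = rsum (\<lambda>a. chi (d * a) * chi (d * a + d))"
      unfolding J_def
      by (rule rsum_scale[symmetric, OF _ that])
        (intro arg_cong2[where f = "(*)"] chi_cong cong_add cong_refl; assumption)
    also have "\<dots> = rsum (\<lambda>a. (chi d * chi d) * (chi a * chi (a + 1)))"
    proof (intro sum.cong refl)
      fix a
      show "chi (d * a) * chi (d * a + d) = (chi d * chi d) * (chi a * chi (a + 1))"
        using chi_mult[of d a] chi_mult[of d "a + 1"] by (simp add: distrib_left mult_ac)
    qed
    finally show ?thesis using that by (simp add: chi_square J_def)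
  qed
  have "rsum J = rsum (\<lambda>a. chi a * rsum (\<lambda>d. chi (a + d)))"
    unfolding J_def by (subst sum.swap) (simp add: sum_distrib_left)
  also have "\<dots> = 0" using rsum_shift(2)[of chi, OF chi_cong] by (simp add: rsum_chi)
  finally have "rsum J = 0" .
  moreover have "rsum J = rsum (\<lambda>d. if int p dvd d then int p - 1 else J 1)"
  proof (intro sum.cong refl)
    fix d show "J d = (if int p dvd d then int p - 1 else J 1)"
      using J_zero[of d] J_one[of d] by simp
  qed
  ultimately have "0 = rsum (\<lambda>d. if int p dvd d then int p - 1 else J 1)" by simp
  then have "(int p - 1) * (1 + J 1) = 0" by (simp only: rsum_const_nonzero distrib_left mult_1_right)
  then have "J 1 = - 1" using p_gt_2 by auto
  then show ?thesis using J_zero J_one unfolding J_def by auto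
qed

end

section \<open>Jacobsthal sums\<close>

context primitive_root
begin

definition jacobsthal :: "int \<Rightarrow> int" where
  "jacobsthal a = rsum (\<lambda>x. chi x * chi (x\<^sup>2 + a))"

lemma jacobsthal_cong:
  assumes "[a = b] (mod int p)" shows "jacobsthal a = jacobsthal b"
  unfolding jacobsthal_def using assms
  by (intro sum.cong refl arg_cong2[where f = "(*)"] chi_cong cong_add cong_refl)

lemma jacobsthal_zero: "jacobsthal 0 = 0"
proof -
  have "jacobsthal 0 = rsum chi"
    unfolding jacobsthal_def
  proof (intro sum.cong refl)
    fix x show "chi x * chi (x\<^sup>2 + 0) = chi x"
      using chi_square[of x] by (cases "int p dvd x") (simp_all add: power2_eq_square chi_mult chi_def[of x])
  qed
  then show ?thesis by (simp add: rsum_chi)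
qed

text \<open>Substituting \<open>b * x\<close> for \<open>x\<close> extracts the factor
  \<open>chi b ^ 3 = chi b\<close>. Up to sign, the sum thus depends only on \<open>a\<close> modulo
  nonzero squares.\<close>

lemma jacobsthal_scale:
  assumes "\<not> int p dvd b"
  shows "jacobsthal (a * b\<^sup>2) = chi b * jacobsthal a"
proof -
  have "jacobsthal (a * b\<^sup>2) = rsum (\<lambda>x. chi (b * x) * chi ((b * x)\<^sup>2 + a * b\<^sup>2))"
    unfolding jacobsthal_def
    by (rule rsum_scale[symmetric, OF _ assms])
      (intro arg_cong2[where f = "(*)"] chi_cong cong_add cong_pow cong_refl; assumption)
  also have "\<dots> = rsum (\<lambda>x. chi b * (chi x * chi (x\<^sup>2 + a)))"
  proof (intro sum.cong refl)
    fix x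
    have "(b * x)\<^sup>2 + a * b\<^sup>2 = b * b * (x\<^sup>2 + a)" by (simp add: power2_eq_square algebra_simps)
    then show "chi (b * x) * chi ((b * x)\<^sup>2 + a * b\<^sup>2) = chi b * (chi x * chi (x\<^sup>2 + a))"
      using assms chi_square[of b] by (simp add: chi_mult)
  qed
  finally show ?thesis by (simp add: jacobsthal_def sum_distrib_left)
qed

text \<open>For a unit \<open>x\<close> only \<open>y = x\<close> and \<open>y = - x\<close> survive
  modulo \<open>p\<close>, with character values \<open>chi (x * x) = 1\<close> and
  \<open>chi (- x * x) = chi (- 1)\<close>. Rescaling \<open>y\<close> by \<open>x\<close> turns
  these two points into 1 and \<open>p - 1\<close>.\<close>

lemma rsum_chi_mult_squares:
  "rsum (\<lambda>y. chi (x * y) * (if int p dvd x\<^sup>2 - y\<^sup>2 then int p else 0)) =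
     (if int p dvd x then 0 else int p * (1 + chi (- 1)))"
proof (cases "int p dvd x")
  case True
  then have "chi (x * y) = 0" for y by (simp add: chi_mult chi_def)
  then show ?thesis using True by simp
next
  case False
  define g where "g y = chi (x * y) * (if int p dvd x\<^sup>2 - y\<^sup>2 then int p else 0)" for y
  have g_cong: "g y = g z" if "[y = z] (mod int p)" for y z
  proof -
    have "[x\<^sup>2 - y\<^sup>2 = x\<^sup>2 - z\<^sup>2] (mod int p)" using that by (intro cong_diff cong_pow cong_refl)
    then have "int p dvd x\<^sup>2 - y\<^sup>2 \<longleftrightarrow> int p dvd x\<^sup>2 - z\<^sup>2" by (rule cong_dvd_iff)
    moreover have "chi (x * y) = chi (x * z)" using that by (intro chi_cong cong_mult cong_refl)
    ultimately show ?thesis by (simp add: g_def)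
  qed
  have "rsum g = rsum (\<lambda>y. g (x * y))" by (rule rsum_scale[symmetric, OF g_cong False])
  also have "\<dots> = (\<Sum>y\<in>{1, int p - 1}. g (x * y))"
  proof (rule sum.mono_neutral_right)
    show "\<forall>y\<in>{0..<int p} - {1, int p - 1}. g (x * y) = 0"
    proof
      fix y assume y: "y \<in> {0..<int p} - {1, int p - 1}"
      \<comment> \<open>The size bound on divisors needs a positive \<open>y - 1\<close>, so 0 is
        kept apart; there \<open>g\<close> vanishes through its character factor.\<close>
      have "y = 0 \<or> \<not> int p dvd y - 1" "y = 0 \<or> \<not> int p dvd y + 1"
        using y zdvd_imp_le[of "int p" "y - 1"] zdvd_imp_le[of "int p" "y + 1"] by force+
      then have "y = 0 \<or> \<not> int p dvd x * x * (1 - y) * (1 + y)"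
        using False prime_int_p by (auto simp: prime_dvd_mult_iff dvd_diff_commute add.commute)
      moreover have "x\<^sup>2 - (x * y)\<^sup>2 = x * x * (1 - y) * (1 + y)"
        by (simp add: power2_eq_square algebra_simps)
      ultimately show "g (x * y) = 0" by (auto simp: g_def)
    qed
  qed (use p_gt_2 in auto)
  also have "\<dots> = g (x * 1) + g (x * (int p - 1))" using p_gt_2 by simp
  also have "g (x * (int p - 1)) = g (- x)"
    by (rule g_cong) (simp add: cong_iff_dvd_diff algebra_simps)
  also have "g (- x) = int p * chi (- 1)"
    using False chi_mult[of "- 1" "x * x"] by (simp add: g_def chi_mult[of x] chi_square)
  also have "g (x * 1) = int p" using False by (simp add: g_def chi_mult[of x] chi_square)
  finally show ?thesis using False by (simp add: g_def algebra_simps)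
qed

text \<open>Second moment: after expanding the square, the sum over \<open>a\<close> comes first and
  is a correlation of two shifts of \<open>chi\<close>, equal to \<open>p - 1\<close> if
  \<open>x^2\<close> and \<open>y^2\<close> agree modulo \<open>p\<close> and to \<open>- 1\<close>
  otherwise. The constant \<open>- 1\<close> is annihilated by the vanishing character sum over
  \<open>y\<close>, and the rest is the preceding count.\<close>

lemma rsum_jacobsthal_square:
  "rsum (\<lambda>a. (jacobsthal a)\<^sup>2) = int p * (int p - 1) * (1 + chi (- 1))"
proof -
  have inner: "rsum (\<lambda>a. chi (x\<^sup>2 + a) * chi (y\<^sup>2 + a)) =
      (if int p dvd x\<^sup>2 - y\<^sup>2 then int p else 0) - 1" for x y
  proof -
    have "rsum (\<lambda>a. chi (a + y\<^sup>2) * chi (a + y\<^sup>2 + (x\<^sup>2 - y\<^sup>2))) =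
        rsum (\<lambda>a. chi a * chi (a + (x\<^sup>2 - y\<^sup>2)))"
      by (rule rsum_shift(1)[where f = "\<lambda>a. chi a * chi (a + (x\<^sup>2 - y\<^sup>2))"])
        (intro arg_cong2[where f = "(*)"] chi_cong cong_add cong_refl; assumption)
    then show ?thesis by (simp add: rsum_chi_mult_shift add.commute mult.commute)
  qed
  have "rsum (\<lambda>a. (jacobsthal a)\<^sup>2) =
      rsum (\<lambda>a. rsum (\<lambda>x. rsum (\<lambda>y. chi (x * y) * (chi (x\<^sup>2 + a) * chi (y\<^sup>2 + a)))))"
    by (simp add: jacobsthal_def power2_eq_square[of "sum _ _"] sum_product chi_mult[of _ "_ :: int"] mult_ac)
  also have "\<dots> = rsum (\<lambda>x. rsum (\<lambda>y. rsum (\<lambda>a. chi (x * y) * (chi (x\<^sup>2 + a) * chi (y\<^sup>2 + a)))))"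
    by (subst sum.swap) (intro sum.cong refl sum.swap)
  also have "\<dots> = rsum (\<lambda>x. rsum (\<lambda>y. chi (x * y) * (if int p dvd x\<^sup>2 - y\<^sup>2 then int p else 0))
      - rsum (\<lambda>y. chi (x * y)))"
    by (simp add: inner sum_subtractf right_diff_distrib flip: sum_distrib_left)
  also have "\<dots> = rsum (\<lambda>x. if int p dvd x then 0 else int p * (1 + chi (- 1)))"
    unfolding rsum_chi_mult_squares by (simp add: chi_mult rsum_chi flip: sum_distrib_left)
  finally show ?thesis by (simp add: rsum_const_nonzero mult_ac)
qed

text \<open>The squared sum is constant on \<open>a\<close> times the nonzero squares and on
  \<open>a * w\<close> times the nonzero squares. These two sets exhaust the nonzero residues, so
  the second moment \<open>2 * p * (p - 1)\<close> is \<open>(p - 1) / 2\<close> times the wanted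
  expression.\<close>

theorem jacobsthal_two_squares:
  assumes "chi (- 1) = 1" and a: "\<not> int p dvd a"
  shows "(jacobsthal a)\<^sup>2 + (jacobsthal (a * w))\<^sup>2 = 4 * int p"
proof -
  define g where "g x = (jacobsthal x)\<^sup>2" for x
  have g_cong: "g x = g y" if "[x = y] (mod int p)" for x y
    using jacobsthal_cong[OF that] by (simp add: g_def)
  have ga_cong: "g (c * x) = g (c * y)" if "[x = y] (mod int p)" for x y c
    using that by (intro g_cong cong_mult cong_refl)
  have g_square: "g (c * y\<^sup>2) = (if int p dvd y then 0 else g c)" for c y
  proof (cases "int p dvd y")
    case True
    then have "g (c * y\<^sup>2) = g 0"
      by (intro g_cong) (simp add: cong_0_iff power2_eq_square)
    then show ?thesis using True by (simp add: g_def jacobsthal_zero)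
  next
    case False
    then show ?thesis using chi_square[of y]
      by (simp add: g_def jacobsthal_scale power_mult_distrib power2_eq_square[of "chi y"])
  qed
  have aw: "\<not> int p dvd a * w" using a w_unit prime_int_p by (simp add: prime_dvd_mult_iff)
  have sum_g: "rsum (\<lambda>x. g (a * x)) = rsum g" "rsum (\<lambda>x. g (a * w * x)) = rsum g"
    using rsum_scale[of g, OF g_cong a] rsum_scale[of g, OF g_cong aw] by simp_all
  \<comment> \<open>When \<open>rsum_square\<close> is applied for \<open>a\<close> and for
    \<open>a * w\<close>, the parts weighted by \<open>chi\<close> cancel, and only two unweighted
    copies of the second moment remain.\<close>
  have twist: "rsum (\<lambda>x. chi x * g (a * w * x)) = - rsum (\<lambda>x. chi x * g (a * x))"
  proof -
    have "rsum (\<lambda>x. chi x * g (a * x)) = rsum (\<lambda>x. chi (w * x) * g (a * (w * x)))"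
      by (rule rsum_scale[symmetric, OF _ w_unit])
        (intro arg_cong2[where f = "(*)"] chi_cong ga_cong; assumption)
    then show ?thesis by (simp add: chi_mult sum_negf mult_ac)
  qed
  have "(int p - 1) * (g a + g (a * w)) = rsum (\<lambda>y. g (a * y\<^sup>2)) + rsum (\<lambda>y. g (a * w * y\<^sup>2))"
    by (simp add: g_square rsum_const_nonzero distrib_left)
  also have "\<dots> = rsum (\<lambda>x. (1 + chi x) * g (a * x)) + rsum (\<lambda>x. (1 + chi x) * g (a * w * x))"
    by (intro arg_cong2[where f = "(+)"] rsum_square ga_cong)
  also have "\<dots> = 2 * rsum g" by (simp add: distrib_right sum.distrib twist sum_g)
  also have "\<dots> = (int p - 1) * (4 * int p)"
    using rsum_jacobsthal_square assms(1) unfolding g_def by simp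
  finally show ?thesis using p_gt_2 unfolding g_def by (simp del: distrib_left_numeral)
qed

end

section \<open>Quartic cyclotomic classes\<close>

context primitive_root
begin

lemma not_dvd_minus_1: "\<not> int p dvd - 1"
proof
  assume "int p dvd - 1"
  then have "int p dvd 1" by simp
  then show False using zdvd_imp_le[of "int p" 1] p_gt_2 by simp
qed

text \<open>The fourth power is removed by \<open>rsum_square\<close> with \<open>v\<close> in place
  of \<open>u^2\<close>. The part weighted by \<open>chi v = - chi (w * v)\<close> is minus a
  Jacobsthal sum. The unweighted part is a sum over \<open>v^2 - 1\<close>; a second use of
  \<open>rsum_square\<close> reduces it to a full character sum, which is 0, and a correlation,
  which is \<open>- 1\<close>.\<close>

lemma rsum_chi_quartic:
  "rsum (\<lambda>u. chi (w\<^sup>2 * u ^ 4 - 1)) = - 1 - jacobsthal (- 1)"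
proof -
  have cong1: "chi (x\<^sup>2 - 1) = chi (y\<^sup>2 - 1)" if "[x = y] (mod int p)" for x y
    using that by (intro chi_cong cong_diff cong_pow cong_refl)
  have cong2: "chi x * chi (x\<^sup>2 - 1) = chi y * chi (y\<^sup>2 - 1)" if "[x = y] (mod int p)" for x y
    using cong1[OF that] chi_cong[OF that] by simp
  have "rsum (\<lambda>u. chi (w\<^sup>2 * u ^ 4 - 1)) = rsum (\<lambda>u. chi ((w * u\<^sup>2)\<^sup>2 - 1))"
    by (simp add: power_mult_distrib flip: power_mult)
  also have "\<dots> = rsum (\<lambda>v. (1 + chi v) * chi ((w * v)\<^sup>2 - 1))"
    by (rule rsum_square) (intro cong1 cong_mult cong_refl)
  also have "\<dots> = rsum (\<lambda>v. chi ((w * v)\<^sup>2 - 1)) - rsum (\<lambda>v. chi (w * v) * chi ((w * v)\<^sup>2 - 1))"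
    by (simp add: distrib_right sum.distrib chi_mult[of w] sum_negf)
  also have "rsum (\<lambda>v. chi (w * v) * chi ((w * v)\<^sup>2 - 1)) = jacobsthal (- 1)"
    unfolding jacobsthal_def
    using rsum_scale[of "\<lambda>v. chi v * chi (v\<^sup>2 - 1)", OF cong2 w_unit] by simp
  also have "rsum (\<lambda>v. chi ((w * v)\<^sup>2 - 1)) = rsum (\<lambda>v. chi (v\<^sup>2 - 1))"
    by (rule rsum_scale[of "\<lambda>v. chi (v\<^sup>2 - 1)", OF cong1 w_unit])
  also have "\<dots> = rsum (\<lambda>x. (1 + chi x) * chi (x - 1))"
    by (rule rsum_square) (intro chi_cong cong_diff cong_refl)
  also have "\<dots> = rsum (\<lambda>x. chi (x + (- 1))) + rsum (\<lambda>x. chi x * chi (x + (- 1)))"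
    by (simp add: distrib_right sum.distrib)
  also have "\<dots> = - 1"
    using rsum_shift(1)[of chi "- 1", OF chi_cong] not_dvd_minus_1
    by (simp only: rsum_chi rsum_chi_mult_shift) simp
  finally show ?thesis .
qed

text \<open>The index of the quartic class containing \<open>x - 1\<close>, where
  \<open>x = w ^ (4 * k + 2)\<close> is the \<open>k\<close>-th element of
  \<open>C2\<close>.\<close>

definition cyclotomic_exponent :: "nat \<Rightarrow> nat" where
  "cyclotomic_exponent k = dlog (w ^ (4 * k + 2) - 1) mod 4"

end

text \<open>\<open>m\<close> is the value that all four class counts turn out to have;
  \<open>T\<close> stands for \<open>2 * t\<close>.\<close>

locale quartic_primitive_root = primitive_root +
  fixes m :: nat and T :: int
  assumes p_eq: "p = 1 + 16 * m" and p_square: "int p = 1 + T\<^sup>2" and T_even: "even T"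
begin

lemma p_minus_1: "p - 1 = 16 * m"
  using p_eq by simp

text \<open>Twice this logarithm is divisible by \<open>p - 1 = 16 * m\<close>, so the logarithm is
  divisible by \<open>8 * m\<close>. Hence a change of sign preserves both \<open>chi\<close> and
  the quartic class.\<close>

lemma dlog_minus_1: "[dlog (- 1) = 0] (mod 8)"
proof -
  have "[dlog (- 1 * - 1) = dlog (- 1) + dlog (- 1)] (mod p - 1)"
    by (intro dlog_mult not_dvd_minus_1)
  moreover have "[dlog (- 1 * - 1) = 0] (mod p - 1)" using dlog_pow[of 0] by simp
  ultimately have "[dlog (- 1) + dlog (- 1) = 0] (mod 16 * m)"
    unfolding p_minus_1 by (metis cong_sym cong_trans)
  then have "2 * (8 * m) dvd 2 * dlog (- 1)" by (simp add: cong_0_iff flip: mult_2)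
  then have "[dlog (- 1) = 0] (mod 8 * m)" unfolding cong_0_iff by (simp only: dvd_times_left_cancel_iff)
  then show ?thesis by (rule cong_dvd_modulus_nat) simp
qed

lemma chi_minus_1: "chi (- 1) = 1"
proof -
  have "\<not> int p dvd - 1" by (rule not_dvd_minus_1)
  moreover have "even (dlog (- 1))"
    using cong_dvd_modulus_nat[OF dlog_minus_1, of 2] by (simp add: cong_0_iff)
  ultimately show ?thesis by (simp add: chi_def)
qed

lemma dlog_mult_mod_4:
  assumes "\<not> int p dvd x" "\<not> int p dvd y"
  shows "[dlog (x * y) = dlog x + dlog y] (mod 4)"
  using dlog_mult[OF assms] unfolding p_minus_1 by (rule cong_dvd_modulus_nat) simp

lemma dlog_pow_mod_4: "[dlog (w ^ k) = k] (mod 4)"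
  using dlog_pow unfolding p_minus_1 by (rule cong_dvd_modulus_nat) simp

text \<open>The element 1 has exponent 0, which differs from 2 modulo 4, and 4 divides
  \<open>p - 1\<close>. This is why 0 is not in \<open>- 1 + C2\<close>.\<close>

lemma not_dvd_cyclotomic: "\<not> int p dvd w ^ (4 * k + 2) - 1"
proof
  assume "int p dvd w ^ (4 * k + 2) - 1"
  then have "[w ^ (4 * k + 2) = w ^ 0] (mod int p)" by (simp add: cong_iff_dvd_diff)
  then have "[4 * k + 2 = 0] (mod p - 1)" by (simp only: pow_cong_iff)
  then have "[4 * k + 2 = 0] (mod 4)" by (rule cong_dvd_modulus_nat) (simp add: p_eq)
  then have "4 dvd 4 * k + 2" by (simp only: cong_0_iff)
  then show False by presburger
qed

text \<open>
  With \<open>x = w ^ (4 * k + 2)\<close>, the reflected index \<open>4 * m - 1 - k\<close> belongs to \<open>1 / x\<close>, and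
  \<open>1 / x - 1 = - (x - 1) / x\<close>.
\<close>

lemma cyclotomic_exponent_reflect:
  assumes "k < 4 * m"
  shows "cyclotomic_exponent (4 * m - 1 - k) = (cyclotomic_exponent k + 2) mod 4"
proof -
  define x where "x = w ^ (4 * k + 2)"
  define x' where "x' = w ^ (4 * (4 * m - 1 - k) + 2)"
  have "x * x' = w ^ (4 * k + 2 + (4 * (4 * m - 1 - k) + 2))"
    unfolding x_def x'_def by (rule power_add[symmetric])
  also have "4 * k + 2 + (4 * (4 * m - 1 - k) + 2) = p - 1" using assms p_eq by simp
  finally have "[x * x' = 1] (mod int p)" using fermat by simp
  then have "[x * x' - x = 1 - x] (mod int p)" by (rule cong_diff) (rule cong_refl)
  then have "[x * (x' - 1) = - 1 * (x - 1)] (mod int p)" by (simp add: algebra_simps)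
  then have "dlog (x * (x' - 1)) = dlog (- 1 * (x - 1))" by (rule dlog_cong)
  moreover have "[dlog (- 1 * (x - 1)) = dlog (- 1) + dlog (x - 1)] (mod 4)"
    unfolding x_def by (intro dlog_mult_mod_4 not_dvd_cyclotomic not_dvd_minus_1)
  moreover have "[dlog (- 1) + dlog (x - 1) = 0 + dlog (x - 1)] (mod 4)"
    by (intro cong_add cong_refl cong_dvd_modulus_nat[OF dlog_minus_1]) simp
  moreover have "[dlog (x * (x' - 1)) = dlog x + dlog (x' - 1)] (mod 4)"
    unfolding x_def x'_def by (intro dlog_mult_mod_4 pow_unit not_dvd_cyclotomic)
  moreover have "[dlog x + dlog (x' - 1) = 2 + dlog (x' - 1)] (mod 4)"
  proof (intro cong_add cong_refl)
    have "[4 * k + 2 = 2] (mod 4)" unfolding cong_def by presburger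
    then show "[dlog x = 2] (mod 4)" unfolding x_def by (rule cong_trans[OF dlog_pow_mod_4])
  qed
  ultimately have "(2 + dlog (x' - 1)) mod 4 = (0 + dlog (x - 1)) mod 4"
    unfolding cong_def by metis
  then have "(dlog (x - 1) mod 4 + 2) mod 4 = ((2 + dlog (x' - 1)) mod 4 + 2) mod 4" by simp
  also have "\<dots> = (dlog (x' - 1) + 4) mod 4" unfolding mod_add_left_eq by (simp add: add.commute)
  finally have "dlog (x' - 1) mod 4 = (dlog (x - 1) mod 4 + 2) mod 4" by simp
  then show ?thesis unfolding cyclotomic_exponent_def x_def x'_def .
qed

text \<open>The cyclotomic number (i, 2) of order 4, called \<open>n_i\<close> in the overview; the
  range of \<open>k\<close> lists each element of \<open>C2\<close> once.\<close>

abbreviation cyc :: "nat \<Rightarrow> nat" where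
  "cyc i \<equiv> card {k \<in> {..<4 * m}. cyclotomic_exponent k = i}"

text \<open>The reflection is an involution of the index range that shifts the exponent by 2, so it
  exchanges the two fibres.\<close>

lemma cyc_reflect:
  assumes "i < 4" and "j = (i + 2) mod 4" shows "cyc i = cyc j"
proof -
  define r where "r k = 4 * m - 1 - k" for k
  have r: "r k < 4 * m" "r (r k) = k" "cyclotomic_exponent (r k) = (cyclotomic_exponent k + 2) mod 4"
    if "k < 4 * m" for k
    using that cyclotomic_exponent_reflect[OF that] by (auto simp: r_def)
  have "(j + 2) mod 4 = i" using assms by presburger
  then have "bij_betw r {k \<in> {..<4 * m}. cyclotomic_exponent k = i}
      {k \<in> {..<4 * m}. cyclotomic_exponent k = j}"
    by (intro bij_betw_byWitness[where f' = r]) (auto simp: r assms(2))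
  then show ?thesis by (rule bij_betw_same_card)
qed

lemma sum_cyclotomic_exponent:
  fixes g :: "nat \<Rightarrow> int"
  shows "(\<Sum>k<4 * m. g (cyclotomic_exponent k)) = (\<Sum>i<4. int (cyc i) * g i)"
proof -
  have "(\<Sum>k<4 * m. g (cyclotomic_exponent k)) =
      (\<Sum>i<4. \<Sum>k\<in>{k \<in> {..<4 * m}. cyclotomic_exponent k = i}. g (cyclotomic_exponent k))"
  proof (rule sum.group[of "{..<4 * m}" "{..<4}" cyclotomic_exponent "\<lambda>k. g (cyclotomic_exponent k)", symmetric])
    show "cyclotomic_exponent ` {..<4 * m} \<subseteq> {..<4}"
      unfolding cyclotomic_exponent_def image_subset_iff lessThan_iff by simp
  qed (rule finite_lessThan)+
  also have "\<dots> = (\<Sum>i<4. int (cyc i) * g i)" by (intro sum.cong refl) simp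
  finally show ?thesis .
qed

text \<open>As \<open>u\<close> runs through the nonzero residues, \<open>w^2 * u^4\<close> covers
  \<open>C2\<close> four times. The term \<open>u = 0\<close> of the complete sum is
  \<open>chi (- 1) = 1\<close>, and its removal turns \<open>- 1\<close> into
  \<open>- 2\<close>.\<close>

lemma sum_chi_cyclotomic:
  "4 * (\<Sum>k<4 * m. chi (w ^ (4 * k + 2) - 1)) = - 2 - jacobsthal (- 1)"
proof -
  define g where "g k = chi (w ^ (4 * k + 2) - 1)" for k
  have "g (k + 4 * m) = g k" for k
    unfolding g_def
  proof (intro chi_cong cong_diff cong_refl pow_cong)
    have "4 * (k + 4 * m) + 2 = 4 * k + 2 + (p - 1)" unfolding p_minus_1 by simp
    then show "[4 * (k + 4 * m) + 2 = 4 * k + 2] (mod p - 1)"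
      by (simp only: cong_def mod_add_self2)
  qed
  then have "4 * (\<Sum>k<4 * m. g k) = (\<Sum>k<4 * (4 * m). g k)"
    by (subst sum_lessThan_periodic) simp_all
  also have "\<dots> = (\<Sum>k<p - 1. chi (w\<^sup>2 * (w ^ k) ^ 4 - 1))"
  proof -
    have "w ^ (4 * k + 2) = w\<^sup>2 * (w ^ k) ^ 4" for k
      by (simp add: power_add power2_eq_square mult_ac flip: power_mult)
    then show ?thesis unfolding g_def p_minus_1 by simp
  qed
  also have "\<dots> = rsum (\<lambda>u. chi (w\<^sup>2 * u ^ 4 - 1)) - chi (- 1)"
    by (subst rsum_pow) (auto intro!: chi_cong cong_diff cong_mult cong_pow)
  finally show ?thesis by (simp add: rsum_chi_quartic chi_minus_1 g_def)
qed

theorem cyclotomic_uniform: "i < 4 \<Longrightarrow> cyc i = m"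
proof -
  have sum_4: "(\<Sum>i<4. f i) = f 0 + f 1 + f 2 + f 3" for f :: "nat \<Rightarrow> int"
    by (simp add: eval_nat_numeral)
  have cyc_sym: "cyc 2 = cyc 0" "cyc 3 = cyc 1" by (rule cyc_reflect; simp)+
  have "4 * int m = (\<Sum>i<4. int (cyc i))" using sum_cyclotomic_exponent[of "\<lambda>_. 1"] by simp
  then have total: "int (cyc 0) + int (cyc 1) = 2 * int m"
    unfolding sum_4 cyc_sym by simp
  \<comment> \<open>By the reflection only \<open>cyc 0 = cyc 1\<close> is left to show;
    \<open>chi\<close> separates even from odd classes and so measures their difference.\<close>
  have "chi (w ^ (4 * k + 2) - 1) = (- 1) ^ cyclotomic_exponent k" for k
  proof -
    have "even (n mod 4) = even n" for n :: nat by (simp add: dvd_mod_iff)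
    then show ?thesis
      using not_dvd_cyclotomic[of k] by (simp add: chi_def cyclotomic_exponent_def minus_one_power_iff)
  qed
  then have "(\<Sum>k<4 * m. chi (w ^ (4 * k + 2) - 1)) = (\<Sum>i<4. int (cyc i) * (- 1) ^ i)"
    using sum_cyclotomic_exponent[of "\<lambda>i. (- 1) ^ i"] by simp
  also have "\<dots> = 2 * (int (cyc 0) - int (cyc 1))" unfolding sum_4 cyc_sym by simp
  finally have S: "(\<Sum>k<4 * m. chi (w ^ (4 * k + 2) - 1)) = 2 * (int (cyc 0) - int (cyc 1))" .
  have J: "jacobsthal (- 1) = 2 * (- 1 - 4 * (int (cyc 0) - int (cyc 1)))"
    using sum_chi_cyclotomic unfolding S by (simp add: algebra_simps)
  define u where "u = - 1 - 4 * (int (cyc 0) - int (cyc 1))"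
  have sq: "(2 * u)\<^sup>2 + (jacobsthal (- 1 * w))\<^sup>2 = 4 * int p"
    using jacobsthal_two_squares[OF chi_minus_1 not_dvd_minus_1] J unfolding u_def by simp
  \<comment> \<open>The second Jacobsthal sum is even as well, so a factor 4 cancels and
    \<open>p\<close> itself becomes a sum of two squares, one with odd base
    \<open>u\<close>.\<close>
  then have "(jacobsthal (- 1 * w))\<^sup>2 = 2 * (2 * (int p - u\<^sup>2))" by (simp add: power2_eq_square)
  then have "even ((jacobsthal (- 1 * w))\<^sup>2)" by (metis dvd_triv_left)
  then obtain v where v: "jacobsthal (- 1 * w) = 2 * v" by auto
  have "int p = u\<^sup>2 + v\<^sup>2" using sq unfolding v by (simp add: power2_eq_square)
  moreover have "odd u" unfolding u_def by simp
  ultimately have "u\<^sup>2 = 1" using two_squares_unique[OF prime_int_p p_square] T_even by blast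
  \<comment> \<open>The sign is settled modulo 4: \<open>u = 1\<close> would make 2 a multiple of 4,
    so \<open>u = - 1\<close> and the counts agree.\<close>
  then have "u = 1 \<or> u = - 1" by (simp add: power2_eq_1_iff)
  then have "int (cyc 0) = int (cyc 1)" unfolding u_def by presburger
  then have "cyc 0 = m" "cyc 1 = m" using total by linarith+
  moreover assume "i < 4"
  then have "i = 0 \<or> i = 1 \<or> i = 2 \<or> i = 3" by linarith
  ultimately show "cyc i = m" using cyc_sym by metis
qed

section \<open>Intersections of \<open>- 1 + C2\<close> with the cosets of \<open>C0\<close>\<close>

definition quartic :: "int set" where
  "quartic = {w ^ (4 * k) mod int p | k. True}"

text \<open>The set \<open>A\<close> of the overview, by representatives in \<open>0..<p\<close>;
  with the bound on \<open>k\<close> the parametrisation is injective.\<close>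

definition shifted_class :: "int set" where
  "shifted_class = (\<lambda>k. (w ^ (4 * k + 2) - 1) mod int p) ` {..<4 * m}"

lemma shifted_class_eq: "shifted_class = {(w ^ (4 * k + 2) - 1) mod int p | k. True}"
proof -
  have "(w ^ (4 * k + 2) - 1) mod int p = (w ^ (4 * (k mod (4 * m)) + 2) - 1) mod int p" for k
  proof -
    have "4 * k + 2 = 4 * (k mod (4 * m)) + 2 + 16 * m * (k div (4 * m))"
      using mult_div_mod_eq[of "4 * m" k] by (simp add: algebra_simps)
    then have "[4 * k + 2 = 4 * (k mod (4 * m)) + 2] (mod p - 1)"
      by (simp only: p_minus_1 cong_def mod_mult_self2)
    then have "[w ^ (4 * k + 2) - 1 = w ^ (4 * (k mod (4 * m)) + 2) - 1] (mod int p)"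
      by (intro cong_diff cong_refl pow_cong)
    then show ?thesis by (simp only: cong_def)
  qed
  moreover have "m > 0" using p_gt_2 p_eq by simp
  ultimately show ?thesis unfolding shifted_class_def by fastforce
qed

lemma inj_shifted: "inj_on (\<lambda>k. (w ^ (4 * k + 2) - 1) mod int p) {..<4 * m}"
proof (rule inj_onI)
  fix k l assume kl: "k \<in> {..<4 * m}" "l \<in> {..<4 * m}"
    and "(w ^ (4 * k + 2) - 1) mod int p = (w ^ (4 * l + 2) - 1) mod int p"
  then have "[w ^ (4 * k + 2) - 1 = w ^ (4 * l + 2) - 1] (mod int p)" by (simp add: cong_def)
  then have "[w ^ (4 * k + 2) = w ^ (4 * l + 2)] (mod int p)"
    by (simp only: cong_iff_dvd_diff) simp
  then have "[4 * k + 2 = 4 * l + 2] (mod p - 1)" by (simp only: pow_cong_iff)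
  then have "[4 * k = 4 * l] (mod 16 * m)" using p_eq by (simp only: cong_add_rcancel_nat) simp
  then show "k = l" using kl by (simp add: cong_def)
qed

lemma card_shifted_class: "card shifted_class = 4 * m"
  unfolding shifted_class_def using inj_shifted by (simp add: card_image)

lemma shifted_class_unit: "a \<in> shifted_class \<Longrightarrow> \<not> int p dvd a"
  unfolding shifted_class_def using not_dvd_cyclotomic by (auto simp: dvd_mod_iff)

lemma card_quartic: "card quartic = 4 * m"
proof -
  have "quartic = (\<lambda>k. w ^ (4 * k) mod int p) ` {..<4 * m}"
  proof -
    have "w ^ (4 * k) mod int p = w ^ (4 * (k mod (4 * m))) mod int p" for k
      using pow_cong[of "4 * k" "4 * (k mod (4 * m))"] p_eq by (simp add: cong_def mult_mod_right)
    then show ?thesis unfolding quartic_def using p_gt_2 p_eq by fastforce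
  qed
  moreover have "inj_on (\<lambda>k. w ^ (4 * k) mod int p) {..<4 * m}"
  proof (rule inj_onI)
    fix k l assume kl: "k \<in> {..<4 * m}" "l \<in> {..<4 * m}"
      and "w ^ (4 * k) mod int p = w ^ (4 * l) mod int p"
    then have "[4 * k = 4 * l] (mod p - 1)" by (simp add: pow_cong_iff flip: cong_def)
    then show "k = l" using kl p_eq by (simp add: cong_def)
  qed
  ultimately show ?thesis by (simp add: card_image)
qed

lemma card_dlog_shifted_class:
  assumes "i < 4" shows "card {a \<in> shifted_class. dlog a mod 4 = i} = m"
proof -
  have "dlog ((w ^ (4 * k + 2) - 1) mod int p) mod 4 = cyclotomic_exponent k" for k
    unfolding cyclotomic_exponent_def by (intro arg_cong2[where f = "(mod)"] dlog_cong) simp_all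
  then have "{a \<in> shifted_class. dlog a mod 4 = i} =
      (\<lambda>k. (w ^ (4 * k + 2) - 1) mod int p) ` {k \<in> {..<4 * m}. cyclotomic_exponent k = i}"
    unfolding shifted_class_def by auto
  moreover have "inj_on (\<lambda>k. (w ^ (4 * k + 2) - 1) mod int p) {k \<in> {..<4 * m}. cyclotomic_exponent k = i}"
    by (rule inj_on_subset[OF inj_shifted]) auto
  ultimately show ?thesis using cyclotomic_uniform[OF assms] by (simp add: card_image)
qed

text \<open>For \<open>a\<close> in \<open>A\<close> a factor \<open>c\<close> in \<open>C0\<close>
  with \<open>c * a = y\<close> exists exactly if the logarithms of \<open>a\<close> and
  \<open>y\<close> agree modulo 4, and it is then unique. So projecting to \<open>a\<close> is a
  bijection onto the part of \<open>A\<close> in the coset of \<open>y\<close>.\<close>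

lemma card_quartic_times_shifted:
  assumes y: "y \<in> {1..<int p}"
  shows "card {(c, a). c \<in> quartic \<and> a \<in> shifted_class \<and> c * a mod int p = y} = m"
    (is "card ?L = m")
proof -
  let ?R = "{a \<in> shifted_class. dlog a mod 4 = dlog y mod 4}"
  have y_unit: "\<not> int p dvd y" using y zdvd_imp_le[of "int p" y] by auto
  have img: "snd ` ?L = ?R"
  proof (intro equalityI subsetI)
    fix a assume "a \<in> snd ` ?L"
    then obtain k where a: "a \<in> shifted_class" and "(w ^ (4 * k) mod int p) * a mod int p = y"
      unfolding quartic_def by auto
    then have "dlog (w ^ (4 * k) * a) = dlog y"
      by (intro dlog_cong) (auto simp: cong_def mod_simps)
    moreover have "[dlog (w ^ (4 * k) * a) = dlog (w ^ (4 * k)) + dlog a] (mod 4)"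
      using a by (intro dlog_mult_mod_4 pow_unit shifted_class_unit)
    moreover have "[dlog (w ^ (4 * k)) + dlog a = 0 + dlog a] (mod 4)"
      using dlog_pow_mod_4[of "4 * k"] by (intro cong_add cong_refl) (simp add: cong_def)
    ultimately have "dlog a mod 4 = dlog y mod 4" unfolding cong_def by (metis add_0)
    then show "a \<in> ?R" using a by simp
  next
    fix a assume a: "a \<in> ?R"
    \<comment> \<open>The exponent of \<open>y / a\<close>; the added multiple of
      \<open>p - 1 = 16 * m\<close> keeps the subtraction on \<open>nat\<close> from
      truncating.\<close>
    define j where "j = dlog y + 16 * m * dlog a - dlog a"
    have m: "m > 0" using p_eq p_gt_2 by simp
    then have le: "dlog a \<le> 16 * m * dlog a" by simp
    have j: "j + dlog a = dlog y + 16 * m * dlog a"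
      unfolding j_def by (rule le_add_diff_inverse2) (rule trans_le_add2[OF le])
    have "[j + dlog a = 0 + dlog a] (mod 4)"
    proof -
      have "j + dlog a = dlog y + 4 * (4 * m * dlog a)" using j by simp
      then have "[j + dlog a = dlog y] (mod 4)" by (simp only: cong_def mod_mult_self2)
      then show ?thesis using a by (simp add: cong_def)
    qed
    then have "4 dvd j" by (simp only: cong_add_rcancel_nat cong_0_iff)
    then obtain k where k: "j = 4 * k" by blast
    have "[w ^ j * a = w ^ j * w ^ dlog a] (mod int p)"
      using a by (intro cong_mult cong_refl dlog shifted_class_unit) simp
    also have "w ^ j * w ^ dlog a = w ^ (j + dlog a)" by (rule power_add[symmetric])
    also have "[w ^ (j + dlog a) = w ^ dlog y] (mod int p)"
      unfolding j by (rule pow_cong) (simp only: p_minus_1 cong_def mod_mult_self2)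
    also have "[w ^ dlog y = y] (mod int p)" using dlog[OF y_unit] by (rule cong_sym)
    finally have "(w ^ (4 * k) mod int p) * a mod int p = y"
      using y unfolding k by (simp add: cong_def mod_simps)
    then have "(w ^ (4 * k) mod int p, a) \<in> ?L" using a unfolding quartic_def by auto
    then show "a \<in> snd ` ?L" by force
  qed
  have "inj_on snd ?L"
  proof (rule inj_onI)
    fix s s' assume "s \<in> ?L" "s' \<in> ?L" "snd s = snd s'"
    then obtain c c' a where s: "s = (c, a)" "s' = (c', a)" and c: "c \<in> quartic" "c' \<in> quartic"
      and a: "a \<in> shifted_class" and "[c * a = c' * a] (mod int p)"
      by (auto simp: cong_def)
    moreover have "coprime a (int p)"
      using shifted_class_unit[OF a] prime_int_p by (metis coprime_commute prime_imp_coprime)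
    ultimately have "[c = c'] (mod int p)" by (simp add: cong_mult_rcancel)
    then have "c = c'" using c unfolding quartic_def by (auto simp: cong_def)
    then show "s = s'" using s by simp
  qed
  then have "card (snd ` ?L) = card ?L" by (rule card_image)
  then show ?thesis unfolding img using card_dlog_shifted_class[of "dlog y mod 4"] by simp
qed

end

section \<open>Directed strongly regular Cayley graphs\<close>

text \<open>A path through \<open>z\<close> is recorded by the labels of its arcs, the second one
  first: the product of \<open>y * inv z\<close> and \<open>z * inv x\<close> is
  \<open>y * inv x\<close>.\<close>

lemma card_cayley_two_paths:
  assumes "group G" "S \<subseteq> carrier G" "x \<in> carrier G" "y \<in> carrier G"
  shows "card {z. (x, z) \<in> parcs (cayley_digraph G S) \<and> (z, y) \<in> parcs (cayley_digraph G S)} =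
    card {(s, s'). s \<in> S \<and> s' \<in> S \<and> s \<otimes>\<^bsub>G\<^esub> s' = y \<otimes>\<^bsub>G\<^esub> inv\<^bsub>G\<^esub> x}"
proof -
  interpret group G by fact
  have S: "s \<in> carrier G" if "s \<in> S" for s using that assms(2) by blast
  have "bij_betw (\<lambda>z. (y \<otimes>\<^bsub>G\<^esub> inv\<^bsub>G\<^esub> z, z \<otimes>\<^bsub>G\<^esub> inv\<^bsub>G\<^esub> x))
      {z. (x, z) \<in> parcs (cayley_digraph G S) \<and> (z, y) \<in> parcs (cayley_digraph G S)}
      {(s, s'). s \<in> S \<and> s' \<in> S \<and> s \<otimes>\<^bsub>G\<^esub> s' = y \<otimes>\<^bsub>G\<^esub> inv\<^bsub>G\<^esub> x}"
  proof (rule bij_betw_byWitness[where f' = "\<lambda>(s, s'). s' \<otimes>\<^bsub>G\<^esub> x"])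
    show "\<forall>z\<in>{z. (x, z) \<in> parcs (cayley_digraph G S) \<and> (z, y) \<in> parcs (cayley_digraph G S)}.
        (case (y \<otimes>\<^bsub>G\<^esub> inv\<^bsub>G\<^esub> z, z \<otimes>\<^bsub>G\<^esub> inv\<^bsub>G\<^esub> x) of (s, s') \<Rightarrow> s' \<otimes>\<^bsub>G\<^esub> x) = z"
      using assms by (simp add: cayley_digraph_def m_assoc)
    have div: "y \<otimes>\<^bsub>G\<^esub> inv\<^bsub>G\<^esub> (s' \<otimes>\<^bsub>G\<^esub> x) = s"
      if "s \<in> S" "s' \<in> S" "s \<otimes>\<^bsub>G\<^esub> s' = y \<otimes>\<^bsub>G\<^esub> inv\<^bsub>G\<^esub> x" for s s'
    proof -
      have "y \<otimes>\<^bsub>G\<^esub> inv\<^bsub>G\<^esub> (s' \<otimes>\<^bsub>G\<^esub> x) = (y \<otimes>\<^bsub>G\<^esub> inv\<^bsub>G\<^esub> x) \<otimes>\<^bsub>G\<^esub> inv\<^bsub>G\<^esub> s'"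
        using that assms S by (simp add: inv_mult_group m_assoc)
      also have "\<dots> = s" using that S by (simp add: m_assoc flip: that(3))
      finally show ?thesis .
    qed
    have mul: "s' \<otimes>\<^bsub>G\<^esub> x \<otimes>\<^bsub>G\<^esub> inv\<^bsub>G\<^esub> x = s'" if "s' \<in> S" for s'
      using that assms S by (simp add: m_assoc)
    show "\<forall>s\<in>{(s, s'). s \<in> S \<and> s' \<in> S \<and> s \<otimes>\<^bsub>G\<^esub> s' = y \<otimes>\<^bsub>G\<^esub> inv\<^bsub>G\<^esub> x}.
        (y \<otimes>\<^bsub>G\<^esub> inv\<^bsub>G\<^esub> (case s of (s, s') \<Rightarrow> s' \<otimes>\<^bsub>G\<^esub> x),
         (case s of (s, s') \<Rightarrow> s' \<otimes>\<^bsub>G\<^esub> x) \<otimes>\<^bsub>G\<^esub> inv\<^bsub>G\<^esub> x) = s"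
      using div mul by auto
    show "(\<lambda>z. (y \<otimes>\<^bsub>G\<^esub> inv\<^bsub>G\<^esub> z, z \<otimes>\<^bsub>G\<^esub> inv\<^bsub>G\<^esub> x)) `
        {z. (x, z) \<in> parcs (cayley_digraph G S) \<and> (z, y) \<in> parcs (cayley_digraph G S)}
        \<subseteq> {(s, s'). s \<in> S \<and> s' \<in> S \<and> s \<otimes>\<^bsub>G\<^esub> s' = y \<otimes>\<^bsub>G\<^esub> inv\<^bsub>G\<^esub> x}"
    proof -
      have "inv\<^bsub>G\<^esub> z \<otimes>\<^bsub>G\<^esub> (z \<otimes>\<^bsub>G\<^esub> inv\<^bsub>G\<^esub> x) = inv\<^bsub>G\<^esub> x" if "z \<in> carrier G" for z
        using that assms by (simp flip: m_assoc)
      then show ?thesis using assms by (auto simp: cayley_digraph_def m_assoc)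
    qed
    show "(\<lambda>(s, s'). s' \<otimes>\<^bsub>G\<^esub> x) `
        {(s, s'). s \<in> S \<and> s' \<in> S \<and> s \<otimes>\<^bsub>G\<^esub> s' = y \<otimes>\<^bsub>G\<^esub> inv\<^bsub>G\<^esub> x}
        \<subseteq> {z. (x, z) \<in> parcs (cayley_digraph G S) \<and> (z, y) \<in> parcs (cayley_digraph G S)}"
      using assms S div mul by (auto simp: cayley_digraph_def)
  qed
  then show ?thesis by (rule bij_betw_same_card)
qed

text \<open>Out-neighbours of \<open>x\<close> are the products \<open>s * x\<close>, in-neighbours
  the products \<open>inv s * x\<close>, which gives regularity. Everything else is a count of
  two-paths.\<close>

lemma directed_srg_cayley:
  assumes "group G" "finite (carrier G)" "S \<subseteq> carrier G" "\<one>\<^bsub>G\<^esub> \<notin> S"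
    and count: "\<And>g. g \<in> carrier G \<Longrightarrow>
      card {(s, s'). s \<in> S \<and> s' \<in> S \<and> s \<otimes>\<^bsub>G\<^esub> s' = g} = (if g \<in> S then l else m)"
  shows "directed_srg (cayley_digraph G S) (order G) (card S) l m m"
proof -
  interpret group G by fact
  let ?D = "cayley_digraph G S"
  have S: "s \<in> carrier G" if "s \<in> S" for s using that assms(3) by blast
  have verts: "pverts ?D = carrier G" by (simp add: cayley_digraph_def)
  have arc: "(x, y) \<in> parcs ?D \<longleftrightarrow> x \<in> carrier G \<and> y \<in> carrier G \<and> y \<otimes>\<^bsub>G\<^esub> inv\<^bsub>G\<^esub> x \<in> S" for x y
    by (simp add: cayley_digraph_def)
  have "finite (parcs ?D)"
    by (rule finite_subset[of _ "carrier G \<times> carrier G"]) (auto simp: arc assms(2))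
  then have "pair_digraph ?D"
    using assms(2,4) by unfold_locales (auto simp: verts arc)
  moreover have "card {y. (x, y) \<in> parcs ?D} = card S" if x: "x \<in> carrier G" for x
  proof -
    have "{y. (x, y) \<in> parcs ?D} = (\<lambda>s. s \<otimes>\<^bsub>G\<^esub> x) ` S"
    proof (intro equalityI subsetI)
      fix y assume "y \<in> {y. (x, y) \<in> parcs ?D}"
      then have "y \<otimes>\<^bsub>G\<^esub> inv\<^bsub>G\<^esub> x \<in> S" "y = y \<otimes>\<^bsub>G\<^esub> inv\<^bsub>G\<^esub> x \<otimes>\<^bsub>G\<^esub> x" using x by (auto simp: arc m_assoc)
      then show "y \<in> (\<lambda>s. s \<otimes>\<^bsub>G\<^esub> x) ` S" by blast
    qed (use x S in \<open>auto simp: arc m_assoc\<close>)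
    moreover have "inj_on (\<lambda>s. s \<otimes>\<^bsub>G\<^esub> x) S" using x S by (auto intro: inj_onI)
    ultimately show ?thesis by (simp add: card_image)
  qed
  moreover have "card {y. (y, x) \<in> parcs ?D} = card S" if x: "x \<in> carrier G" for x
  proof -
    have "{y. (y, x) \<in> parcs ?D} = (\<lambda>s. inv\<^bsub>G\<^esub> s \<otimes>\<^bsub>G\<^esub> x) ` S"
    proof (intro equalityI subsetI)
      fix y assume "y \<in> {y. (y, x) \<in> parcs ?D}"
      then have "x \<otimes>\<^bsub>G\<^esub> inv\<^bsub>G\<^esub> y \<in> S" "y = inv\<^bsub>G\<^esub> (x \<otimes>\<^bsub>G\<^esub> inv\<^bsub>G\<^esub> y) \<otimes>\<^bsub>G\<^esub> x"
        using x by (auto simp: arc m_assoc inv_mult_group)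
      then show "y \<in> (\<lambda>s. inv\<^bsub>G\<^esub> s \<otimes>\<^bsub>G\<^esub> x) ` S" by blast
    next
      fix y assume "y \<in> (\<lambda>s. inv\<^bsub>G\<^esub> s \<otimes>\<^bsub>G\<^esub> x) ` S"
      then obtain s where s: "s \<in> S" "y = inv\<^bsub>G\<^esub> s \<otimes>\<^bsub>G\<^esub> x" by blast
      have "x \<otimes>\<^bsub>G\<^esub> (inv\<^bsub>G\<^esub> x \<otimes>\<^bsub>G\<^esub> s) = s" using x s S by (simp flip: m_assoc)
      then show "y \<in> {y. (y, x) \<in> parcs ?D}" using x s S by (simp add: arc inv_mult_group)
    qed
    moreover have "inj_on (\<lambda>s. inv\<^bsub>G\<^esub> s \<otimes>\<^bsub>G\<^esub> x) S"
    proof (rule inj_onI)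
      fix s t assume st: "s \<in> S" "t \<in> S" "inv\<^bsub>G\<^esub> s \<otimes>\<^bsub>G\<^esub> x = inv\<^bsub>G\<^esub> t \<otimes>\<^bsub>G\<^esub> x"
      then have "inv\<^bsub>G\<^esub> s = inv\<^bsub>G\<^esub> t" using x S by simp
      then show "s = t" using st S by (metis inv_inv)
    qed
    ultimately show ?thesis by (simp add: card_image)
  qed
  moreover have "card {z. (x, z) \<in> parcs ?D \<and> (z, y) \<in> parcs ?D} = (if (x, y) \<in> parcs ?D then l else m)"
    if "x \<in> carrier G" "y \<in> carrier G" for x y
    using that count[of "y \<otimes>\<^bsub>G\<^esub> inv\<^bsub>G\<^esub> x"] card_cayley_two_paths[OF assms(1,3) that] by (simp add: arc)
  moreover have "(x, x) \<notin> parcs ?D" for x using assms(4) by (auto simp: arc)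
  ultimately show ?thesis
    unfolding directed_srg_def verts order_def by simp
qed

text \<open>In a factorisation of \<open>(h, \<psi>)\<close> the second automorphism is determined
  by the first, so \<open>\<psi>\<close> does not affect the count. Each \<open>a\<close> in
  \<open>A\<close> other than \<open>h\<close> admits \<open>m\<close> pairs
  \<open>(\<phi>, a')\<close>; \<open>a = h\<close> admits none, since \<open>\<phi> a'\<close>
  would be the identity while \<open>A\<close> avoids it. The number is thus
  \<open>m * (card A - 1)\<close> or \<open>m * card A\<close> according to whether \<open>h\<close>
  lies in \<open>A\<close>.\<close>

lemma directed_srg_semidirect_product:
  assumes "group H" "subgroup K (AutoGroup H)" "finite (carrier H)" "finite K"
    and A: "A \<subseteq> carrier H" "\<one>\<^bsub>H\<^esub> \<notin> A"
    and count: "\<And>y. y \<in> carrier H \<Longrightarrow> y \<noteq> \<one>\<^bsub>H\<^esub> \<Longrightarrow>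
      card {(\<phi>, a). \<phi> \<in> K \<and> a \<in> A \<and> \<phi> a = y} = m"
  shows "directed_srg (cayley_digraph (semidirect_product H K) (A \<times> K))
    (order H * card K) (card A * card K) (m * (card A - 1)) (m * card A) (m * card A)"
proof -
  interpret H: group H by fact
  interpret Aut: group "AutoGroup H" by (rule H.AutoGroup)
  interpret K: subgroup K "AutoGroup H" by fact
  let ?G = "semidirect_product H K"
  have K_auto: "\<phi> \<in> hom H H" "bij_betw \<phi> (carrier H) (carrier H)" if "\<phi> \<in> K" for \<phi>
    using that K.subset by (auto simp: AutoGroup_def auto_def Bij_def)
  have closed: "\<phi> x \<in> carrier H" if "\<phi> \<in> K" "x \<in> carrier H" for \<phi> x
    using that K_auto by (auto simp: hom_def)
  have app_one: "\<phi> x = \<one>\<^bsub>H\<^esub> \<longleftrightarrow> x = \<one>\<^bsub>H\<^esub>" if "\<phi> \<in> K" "x \<in> carrier H" for \<phi> x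
    using that K_auto[OF that(1)] hom_one[OF _ \<open>group H\<close> \<open>group H\<close>, of \<phi>]
    by (metis H.one_closed bij_betw_def inj_onD)
  have finA: "finite A" using A(1) assms(3) finite_subset by blast
  have fin: "finite {(\<phi>, a). \<phi> \<in> K \<and> a \<in> A \<and> \<phi> a = y}" for y
    by (rule finite_subset[of _ "K \<times> A"]) (use finA \<open>finite K\<close> in auto)
  have pairs: "card {(s, s'). s \<in> A \<times> K \<and> s' \<in> A \<times> K \<and> s \<otimes>\<^bsub>?G\<^esub> s' = (h, \<psi>)} =
      m * (card A - (if h \<in> A then 1 else 0))" (is "card ?P = _")
    if h: "h \<in> carrier H" and \<psi>: "\<psi> \<in> K" for h \<psi>
  proof -
    let ?Q = "SIGMA a:A. {(\<phi>, a'). \<phi> \<in> K \<and> a' \<in> A \<and> \<phi> a' = inv\<^bsub>H\<^esub> a \<otimes>\<^bsub>H\<^esub> h}"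
    have "bij_betw (\<lambda>((a, \<phi>), (a', \<phi>')). (a, \<phi>, a')) ?P ?Q"
    proof (rule bij_betw_byWitness[where
          f' = "\<lambda>(a, \<phi>, a'). ((a, \<phi>), (a', inv\<^bsub>AutoGroup H\<^esub> \<phi> \<otimes>\<^bsub>AutoGroup H\<^esub> \<psi>))"])
      have cancel: "inv\<^bsub>AutoGroup H\<^esub> \<phi> \<otimes>\<^bsub>AutoGroup H\<^esub> (\<phi> \<otimes>\<^bsub>AutoGroup H\<^esub> \<phi>') = \<phi>'"
        "\<phi> \<otimes>\<^bsub>AutoGroup H\<^esub> (inv\<^bsub>AutoGroup H\<^esub> \<phi> \<otimes>\<^bsub>AutoGroup H\<^esub> \<phi>') = \<phi>'"
        if "\<phi> \<in> K" "\<phi>' \<in> K" for \<phi> \<phi>'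
        using that K.mem_carrier by (simp_all flip: Aut.m_assoc)
      show "\<forall>q\<in>?P. (\<lambda>(a, \<phi>, a'). ((a, \<phi>), (a', inv\<^bsub>AutoGroup H\<^esub> \<phi> \<otimes>\<^bsub>AutoGroup H\<^esub> \<psi>)))
          ((\<lambda>((a, \<phi>), (a', \<phi>')). (a, \<phi>, a')) q) = q"
        by (auto simp: semidirect_product_def cancel)
      show "(\<lambda>((a, \<phi>), (a', \<phi>')). (a, \<phi>, a')) ` ?P \<subseteq> ?Q"
      proof -
        have "inv\<^bsub>H\<^esub> a \<otimes>\<^bsub>H\<^esub> (a \<otimes>\<^bsub>H\<^esub> b) = b" if "a \<in> A" "b \<in> carrier H" for a b
          using that A(1) by (metis H.l_inv H.inv_closed H.l_one H.m_assoc subsetD)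
        then show ?thesis using A(1) closed by (auto simp: semidirect_product_def subset_iff)
      qed
      show "(\<lambda>(a, \<phi>, a'). ((a, \<phi>), (a', inv\<^bsub>AutoGroup H\<^esub> \<phi> \<otimes>\<^bsub>AutoGroup H\<^esub> \<psi>))) ` ?Q \<subseteq> ?P"
      proof -
        have "a \<otimes>\<^bsub>H\<^esub> (inv\<^bsub>H\<^esub> a \<otimes>\<^bsub>H\<^esub> h) = h" if "a \<in> A" for a
          using that h A(1) by (metis H.r_inv H.inv_closed H.l_one H.m_assoc subsetD)
        then show ?thesis using \<psi> by (auto simp: semidirect_product_def cancel)
      qed
    qed auto
    then have "card ?P = card ?Q" by (rule bij_betw_same_card)
    also have "\<dots> = (\<Sum>a\<in>A. card {(\<phi>, a'). \<phi> \<in> K \<and> a' \<in> A \<and> \<phi> a' = inv\<^bsub>H\<^esub> a \<otimes>\<^bsub>H\<^esub> h})"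
      using finA fin by (simp add: card_SigmaI)
    also have "\<dots> = (\<Sum>a\<in>A. if a = h then 0 else m)"
    proof (intro sum.cong refl)
      fix a assume "a \<in> A"
      then have a: "a \<in> carrier H" using A(1) by blast
      show "card {(\<phi>, a'). \<phi> \<in> K \<and> a' \<in> A \<and> \<phi> a' = inv\<^bsub>H\<^esub> a \<otimes>\<^bsub>H\<^esub> h} = (if a = h then 0 else m)"
      proof (cases "a = h")
        case True
        have empty: "{(\<phi>, a'). \<phi> \<in> K \<and> a' \<in> A \<and> \<phi> a' = inv\<^bsub>H\<^esub> a \<otimes>\<^bsub>H\<^esub> h} = {}"
          using A app_one True a by auto
        show ?thesis unfolding empty using True by simp
      next
        case False
        then have "inv\<^bsub>H\<^esub> a \<otimes>\<^bsub>H\<^esub> h \<noteq> \<one>\<^bsub>H\<^esub>"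
          using a h by (metis H.inv_equality H.inv_inv H.inv_closed)
        then show ?thesis using False a h count by simp
      qed
    qed
    also have "\<dots> = (\<Sum>a\<in>A - {h}. m)"
      using finA by (intro sum.mono_neutral_cong_right) auto
    also have "\<dots> = m * (card A - (if h \<in> A then 1 else 0))"
      using finA by simp
    finally show ?thesis .
  qed
  have "directed_srg (cayley_digraph ?G (A \<times> K)) (order ?G) (card (A \<times> K))
      (m * (card A - 1)) (m * card A) (m * card A)"
  proof (rule directed_srg_cayley)
    show "group ?G" using assms(1,2) by (rule group_semidirect_product)
    fix g assume "g \<in> carrier ?G"
    then obtain h \<psi> where "g = (h, \<psi>)" "h \<in> carrier H" "\<psi> \<in> K" by (auto simp: semidirect_product_def)
    then show "card {(s, s'). s \<in> A \<times> K \<and> s' \<in> A \<times> K \<and> s \<otimes>\<^bsub>?G\<^esub> s' = g} =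
        (if g \<in> A \<times> K then m * (card A - 1) else m * card A)"
      using pairs by simp
  qed (use A assms(3,4) in \<open>auto simp: semidirect_product_def\<close>)
  then show ?thesis by (simp add: semidirect_product_def order_def card_cartesian_product)
qed

section \<open>Dilations of a field\<close>

text \<open>Restricted to the carrier because members of \<open>AutoGroup\<close> are
  extensional.\<close>

definition (in ring) dilation :: "'a \<Rightarrow> 'a \<Rightarrow> 'a" where
  "dilation c = (\<lambda>x\<in>carrier R. c \<otimes> x)"

context field
begin

lemma dilation_in_AutoGroup:
  assumes "c \<in> carrier (mult_of R)"
  shows "dilation c \<in> carrier (AutoGroup (add_monoid R))"
proof -
  have c: "c \<in> carrier R" "c \<noteq> \<zero>" using assms by simp_all
  then have inv: "inv c \<in> carrier R" "inv c \<otimes> c = \<one>" "c \<otimes> inv c = \<one>"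
    by (simp_all add: field_Units)
  have cancel: "inv c \<otimes> (c \<otimes> x) = x" "c \<otimes> (inv c \<otimes> x) = x" if "x \<in> carrier R" for x
    using c inv that by (simp_all flip: m_assoc)
  have "bij_betw (dilation c) (carrier R) (carrier R)"
    using c inv cancel
    by (intro bij_betw_byWitness[where f' = "\<lambda>x. inv c \<otimes> x"]) (auto simp: dilation_def)
  moreover have "dilation c \<in> hom (add_monoid R) (add_monoid R)"
    using c by (auto simp: hom_def dilation_def r_distr)
  moreover have "dilation c \<in> extensional (carrier R)" by (simp add: dilation_def)
  ultimately show ?thesis by (simp add: AutoGroup_def auto_def Bij_def)
qed

lemma dilation_mult:
  assumes "c \<in> carrier (mult_of R)" "d \<in> carrier (mult_of R)"
  shows "dilation c \<otimes>\<^bsub>AutoGroup (add_monoid R)\<^esub> dilation d = dilation (c \<otimes> d)"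
  using dilation_in_AutoGroup[OF assms(1)] dilation_in_AutoGroup[OF assms(2)] assms
  by (auto simp: AutoGroup_def BijGroup_def auto_def compose_def dilation_def m_assoc)

lemma dilation_pow:
  assumes "c \<in> carrier (mult_of R)"
  shows "dilation c [^]\<^bsub>AutoGroup (add_monoid R)\<^esub> (k::nat) = dilation (c [^] k)"
proof (induction k)
  case 0
  show ?case by (auto simp: AutoGroup_def BijGroup_def dilation_def)
next
  case (Suc k)
  have "c [^] k \<in> carrier (mult_of R)"
    using monoid.nat_pow_closed[OF group.is_monoid[OF field_mult_group] assms]
    by (simp only: nat_pow_mult_of)
  then show ?case using Suc assms by (simp add: dilation_mult)
qed

lemma inj_dilation: "inj_on dilation (carrier R)"
proof (rule inj_onI)
  fix c d assume "c \<in> carrier R" "d \<in> carrier R" "dilation c = dilation d"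
  then have "dilation c \<one> = dilation d \<one>" by simp
  then show "c = d" using \<open>c \<in> carrier R\<close> \<open>d \<in> carrier R\<close> by (simp add: dilation_def)
qed

text \<open>Both groups are finite, so a single element generates just its natural powers, and
  dilation carries powers to powers. For the generator of \<open>C0\<close> this identifies
  \<open>K\<close> with \<open>C0\<close>.\<close>

lemma generate_dilation:
  assumes fin: "finite (carrier R)" and c: "c \<in> carrier (mult_of R)"
  shows "generate (AutoGroup (add_monoid R)) {dilation c} = dilation ` generate (mult_of R) {c}"
proof -
  have "finite (carrier (AutoGroup (add_monoid R)))"
  proof (rule finite_subset)
    show "carrier (AutoGroup (add_monoid R)) \<subseteq> carrier R \<rightarrow>\<^sub>E carrier R"
      by (auto simp: AutoGroup_def auto_def Bij_def bij_betw_def PiE_def)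
  qed (use fin in \<open>simp add: finite_PiE\<close>)
  then have "generate (AutoGroup (add_monoid R)) {dilation c} = {dilation (c [^] k) | k::nat. True}"
    using group.generate_pow_on_finite_carrier[OF group.AutoGroup[OF add.is_group]]
      dilation_in_AutoGroup[OF c] by (simp add: dilation_pow[OF c])
  moreover have "generate (mult_of R) {c} = {c [^] k | k::nat. True}"
    using group.generate_pow_on_finite_carrier[OF field_mult_group] c fin
    by (simp add: nat_pow_mult_of)
  ultimately show ?thesis by auto
qed

end

section \<open>Translation of the group data into congruences, and the final parameters\<close>

theorem theorem4p4:
  fixes p :: nat and t :: int and \<omega> :: int
  assumes "prime p" and "int p = 1 + 4 * t\<^sup>2" and "even t"
    and F: "F = residue_ring (int p)"
    and \<omega>: "\<omega> \<in> carrier (mult_of F)" "generate (mult_of F) {\<omega>} = carrier (mult_of F)"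
    and C0: "C0 = generate (mult_of F) {\<omega> [^]\<^bsub>F\<^esub> (4::nat)}"
    and C2: "C2 = (\<omega> [^]\<^bsub>F\<^esub> (2::nat)) <#\<^bsub>mult_of F\<^esub> C0"
    and H: "H = add_monoid F"
    and \<rho>: "\<rho> = (\<lambda>x\<in>carrier H. \<omega> [^]\<^bsub>F\<^esub> (4::nat) \<otimes>\<^bsub>F\<^esub> x)"
    and K: "K = generate (AutoGroup H) {\<rho>}"
    and G: "G = semidirect_product H K"
    and W: "W = {(\<ominus>\<^bsub>F\<^esub> \<one>\<^bsub>F\<^esub> \<oplus>\<^bsub>F\<^esub> c, \<phi>) | c \<phi>. c \<in> C2 \<and> \<phi> \<in> K}"
  shows "W \<subseteq> carrier G \<and>
    directed_srg (cayley_digraph G W)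
      ((p - 1) * p div 4)
      ((p - 1)\<^sup>2 div 16)
      ((p - 1)\<^sup>2 div 64 - (p - 1) div 16)
      ((p - 1)\<^sup>2 div 64)
      ((p - 1)\<^sup>2 div 64)"
proof -
  interpret R: residues_prime p F
    by (unfold_locales, rule \<open>prime p\<close>, rule eq_reflection, rule F)
  have carrier: "carrier F = {0..<int p}" by (auto simp: R.res_carrier_eq)
  have units: "carrier (mult_of F) = {1..<int p}" by (auto simp: carrier R.res_zero_eq)
  have p0: "int p > 0" using R.m_gt_one by simp
  obtain m where "p - 1 = 16 * m" using parameters_exact(5)[OF assms(2,3)] by blast
  then have p_eq: "p = 1 + 16 * m" using parameters_exact(1)[OF assms(2,3)] by simp
  have \<omega>_mod: "\<omega> mod int p = \<omega>" using \<omega>(1) unfolding units by simp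
  have pow: "\<omega> [^]\<^bsub>F\<^esub> k = \<omega> ^ k mod int p" for k :: nat
    using R.pow_cong[of \<omega> k] by (simp add: \<omega>_mod)
  have gen: "generate (mult_of F) {c} = {c [^]\<^bsub>F\<^esub> k | k::nat. True}"
    if "c \<in> carrier (mult_of F)" for c
    using group.generate_pow_on_finite_carrier[OF R.field_mult_group] that
    by (simp add: nat_pow_mult_of)
  \<comment> \<open>Here \<open>4 * t^2\<close> is read as \<open>(2 * t)^2\<close>, and
    \<open>generates\<close> comes from writing each unit as a natural power of the
    generator.\<close>
  interpret quartic_primitive_root p \<omega> m "2 * t"
  proof
    show "prime p" "p = 1 + 16 * m" "odd p" "int p = 1 + (2 * t)\<^sup>2" "even (2 * t)"
      using assms(1,2) p_eq by simp_all
    show "\<not> int p dvd \<omega>" using \<omega>(1) zdvd_imp_le[of "int p" \<omega>] unfolding units by auto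
    fix x assume "\<not> int p dvd x"
    then have "x mod int p \<noteq> 0" by (simp add: dvd_eq_mod_eq_0)
    moreover have "x mod int p \<ge> 0" "x mod int p < int p" using p0 by simp_all
    ultimately have "x mod int p \<in> carrier (mult_of F)" unfolding units by simp
    then obtain k :: nat where "x mod int p = \<omega> [^]\<^bsub>F\<^esub> k"
      using gen[OF \<omega>(1)] \<omega>(2) by auto
    then show "\<exists>k. [x = \<omega> ^ k] (mod int p)" by (auto simp: pow cong_def)
  qed
  have pow_units: "\<omega> [^]\<^bsub>F\<^esub> k \<in> carrier (mult_of F)" for k :: nat
    using monoid.nat_pow_closed[OF group.is_monoid[OF R.field_mult_group] \<omega>(1)] by (simp only: nat_pow_mult_of)
  have C0_eq: "C0 = quartic"
    using gen[OF pow_units, of 4] unfolding C0 quartic_def pow R.pow_cong power_mult .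
  have C2_eq: "C2 = {\<omega> ^ (4 * k + 2) mod int p | k. True}"
  proof -
    have "(\<omega> ^ 2 mod int p) \<otimes>\<^bsub>mult_of F\<^esub> (\<omega> ^ (4 * k) mod int p) = \<omega> ^ (4 * k + 2) mod int p" for k
      by (simp only: mult_mult_of R.mult_cong power_add mult.commute)
    then show ?thesis unfolding C2 C0_eq l_coset_def quartic_def pow by blast
  qed
  have A_eq: "{\<ominus>\<^bsub>F\<^esub> \<one>\<^bsub>F\<^esub> \<oplus>\<^bsub>F\<^esub> c | c. c \<in> C2} = shifted_class"
  proof -
    have step: "\<ominus>\<^bsub>F\<^esub> \<one>\<^bsub>F\<^esub> \<oplus>\<^bsub>F\<^esub> (x mod int p) = (x - 1) mod int p" for x
      by (simp add: R.res_add_eq R.res_neg_eq R.res_one_eq mod_simps)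
    have "{\<ominus>\<^bsub>F\<^esub> \<one>\<^bsub>F\<^esub> \<oplus>\<^bsub>F\<^esub> c | c. c \<in> C2} =
        {\<ominus>\<^bsub>F\<^esub> \<one>\<^bsub>F\<^esub> \<oplus>\<^bsub>F\<^esub> (\<omega> ^ (4 * k + 2) mod int p) | k. True}"
      unfolding C2_eq by blast
    then show ?thesis unfolding step shifted_class_eq .
  qed
  have W_eq: "W = shifted_class \<times> K" unfolding W A_eq[symmetric] by blast
  have \<rho>_eq: "\<rho> = R.dilation (\<omega> [^]\<^bsub>F\<^esub> (4::nat))" unfolding \<rho> H R.dilation_def by simp
  have K_eq: "K = R.dilation ` quartic"
    unfolding K H \<rho>_eq C0_eq[symmetric] C0 by (rule R.generate_dilation) (use pow_units in auto)
  have quartic_carrier: "quartic \<subseteq> carrier F" unfolding quartic_def carrier using p0 by auto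
  have inj: "inj_on R.dilation quartic" by (rule inj_on_subset[OF R.inj_dilation quartic_carrier])
  have card_K: "card K = 4 * m" unfolding K_eq by (simp add: card_image inj card_quartic)
  have A_carrier: "shifted_class \<subseteq> carrier H"
    unfolding H shifted_class_def using p0 by (auto simp: carrier)
  have grp: "group H" unfolding H by (rule R.add.is_group)
  have sub: "subgroup K (AutoGroup H)"
    unfolding K \<rho>_eq H
    using R.dilation_in_AutoGroup[OF pow_units]
    by (intro group.generate_is_subgroup group.AutoGroup R.add.is_group) simp
  have dsrg: "directed_srg (cayley_digraph G (shifted_class \<times> K)) (order H * card K)
      (card shifted_class * card K) (m * (card shifted_class - 1))
      (m * card shifted_class) (m * card shifted_class)"
    unfolding G
  proof (rule directed_srg_semidirect_product[OF grp sub _ _ A_carrier])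
    show "finite (carrier H)" by (simp add: H carrier)
    show "finite K" unfolding K_eq using quartic_carrier by (auto intro: finite_subset simp: carrier)
    show "\<one>\<^bsub>H\<^esub> \<notin> shifted_class" using shifted_class_unit by (auto simp: H R.res_zero_eq)
    fix y assume "y \<in> carrier H" "y \<noteq> \<one>\<^bsub>H\<^esub>"
    then have y: "y \<in> {1..<int p}" by (auto simp: H carrier R.res_zero_eq)
    have app: "R.dilation c a = c * a mod int p" if "a \<in> shifted_class" for c a
      using that A_carrier by (auto simp: R.dilation_def R.res_mult_eq H)
    \<comment> \<open>A dilation determines its factor, so the coset count over \<open>C0\<close>
      becomes the count over \<open>K\<close>.\<close>
    have "bij_betw (\<lambda>(c, a). (R.dilation c, a))
        {(c, a). c \<in> quartic \<and> a \<in> shifted_class \<and> c * a mod int p = y}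
        {(\<phi>, a). \<phi> \<in> K \<and> a \<in> shifted_class \<and> \<phi> a = y}"
      unfolding bij_betw_def K_eq
      using inj by (auto simp: app inj_on_def image_iff)
    then show "card {(\<phi>, a). \<phi> \<in> K \<and> a \<in> shifted_class \<and> \<phi> a = y} = m"
      using card_quartic_times_shifted[OF y] by (simp add: bij_betw_same_card)
  qed
  have "order H = p" by (simp add: order_def H carrier)
  \<comment> \<open>Both \<open>A\<close> and \<open>K\<close> have \<open>4 * m\<close> elements,
    and \<open>p - 1 = 16 * m\<close>.\<close>
  moreover have "p * (4 * m) = (p - 1) * p div 4" "4 * m * (4 * m) = (p - 1)\<^sup>2 div 16"
    "m * (4 * m - 1) = (p - 1)\<^sup>2 div 64 - (p - 1) div 16" "m * (4 * m) = (p - 1)\<^sup>2 div 64"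
    unfolding p_eq by (simp_all add: power2_eq_square right_diff_distrib')
  moreover have "W \<subseteq> carrier G"
    unfolding W_eq G using A_carrier by (auto simp: semidirect_product_def)
  ultimately show ?thesis using dsrg unfolding W_eq card_shifted_class card_K by metis
qed

end
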